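(* There exists an absolute constant $C>0$ such that the following holds. Let $\mathcal{A}$ be an increasing sequence of natural numbers, with truncations $A_N$ (the set of the first $N$ elements of $\mathcal{A}$), and suppose that $E(A_N)\ll N^3/(\log N)^C$ for all $N$. Then $\mathcal{A}$ is metric poissonian.
   Context: For a finite set $A\subset\mathbb{N}$, its additive energy is $E(A)=\sum_{n\in\mathbb{Z}} r(n)^2$ where $r(n)=|\{(a,b)\in A^2:a-b=n\}|$. For an increasing sequence $\mathcal{A}$ of natural numbers, $\alpha\in[0,1]$, $s>0$ and $N\in\mathbb{N}$, define \[F(\alpha,s,N,\mathcal{A})=\frac1N\,\#\{(x_i,x_j)\in A_N^2: x_i\neq x_j,\ \Vert\alpha(x_i-x_j)\Vert\leqslant s/N\},\] where $\Vert x\Vert$ denotes the distance from $x$ to the nearest integer. $\mathcal{A}$ is called metric poissonian if for almost all $\alpha\in[0,1]$ (Lebesgue measure), for all $s>0$, $F(\alpha,s,N,\mathcal{A})\to 2s$ as $N\to\infty$. $X\ll Y$ means $|X|\leqslant C'|Y|$ for some constant $C'$ (here possibly depending on the sequence) for all $N$. *)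

theory Defs
  imports "HOL-Analysis.Analysis"
begin

definition diff_reps :: "nat set \<Rightarrow> int \<Rightarrow> nat" where
  "diff_reps A n = card {(a, b) \<in> A \<times> A. int a - int b = n}"

text \<open>For finite \<open>A\<close> the family below has finite support, so the sum over all integers is a finite one.\<close>

definition additive_energy :: "nat set \<Rightarrow> real" where
  "additive_energy A = (\<Sum>\<^sub>\<infinity>n\<in>(UNIV :: int set). real (diff_reps A n) ^ 2)"

definition dist_nearest_int :: "real \<Rightarrow> real" where
  "dist_nearest_int x = \<bar>x - real_of_int (round x)\<bar>"

text \<open>Sequences are indexed from \<open>0\<close>, so the first \<open>N\<close> elements are those of index below \<open>N\<close>.\<close>

definition truncation :: "(nat \<Rightarrow> nat) \<Rightarrow> nat \<Rightarrow> nat set" where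
  "truncation a N = a ` {..<N}"

definition pair_correlation :: "real \<Rightarrow> real \<Rightarrow> nat \<Rightarrow> (nat \<Rightarrow> nat) \<Rightarrow> real" where
  "pair_correlation \<alpha> s N a =
     1 / real N *
     real (card {(x, y) \<in> truncation a N \<times> truncation a N.
                   x \<noteq> y \<and> dist_nearest_int (\<alpha> * (real x - real y)) \<le> s / real N})"

definition metric_poissonian :: "(nat \<Rightarrow> nat) \<Rightarrow> bool" where
  "metric_poissonian a \<longleftrightarrow>
     (AE \<alpha> in lebesgue_on {0..1}.
        \<forall>s>0. (\<lambda>N. pair_correlation \<alpha> s N a) \<longlonglongrightarrow> 2 * s)"

end

theory Submission
  imports Defs "HOL-Real_Asymp.Real_Asymp"
begin

text \<open>
  Over uniform \<open>\<alpha>\<close>, the events \<open>\<parallel>n\<alpha>\<parallel> \<le> \<delta>\<close> and \<open>\<parallel>m\<alpha>\<parallel> \<le> \<delta>\<close> have covariance at most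
  \<open>2\<delta> gcd(n,m)/max(n,m)\<close>, so the variance of the pair correlation is controlled by a GCD sum over the
  differences of \<open>A\<^sub>N\<close>. Writing \<open>n/m = h/k\<close> in lowest terms, the GCD sum is at most a sum of
  \<open>(hk)\<^bsup>-1/2\<^esup>\<close> over coincidences \<open>nk = mh\<close>. Two applications of Cauchy-Schwarz bound its fourth power
  by the square of the additive energy, a power of \<open>log N\<close> coming from moments of the divisor
  function, and the number of solutions of
  \<open>(a\<^sub>1-a\<^sub>2)(a\<^sub>3-a\<^sub>4) = (a\<^sub>5-a\<^sub>6)(a\<^sub>7-a\<^sub>8)\<close> in \<open>A\<^sub>N\<close>. After one more Cauchy-Schwarz that number is \<open>N\<^sup>2\<close>
  times the number of collinear triples in the grid \<open>A\<^sub>N \<times> A\<^sub>N\<close>, which is \<open>O(N\<^sup>4 log N)\<close>. Hence a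
  logarithmic saving in the energy gives a logarithmic saving in the variance, which is summable
  along \<open>N\<^sub>k = \<lceil>exp \<surd>k\<rceil>\<close>; since \<open>N\<^sub>k\<^sub>+\<^sub>1/N\<^sub>k \<rightarrow> 1\<close>, monotonicity of the pair count fills the gaps.
\<close>

section \<open>Coincidence sums\<close>

text \<open>A weighted energy: with both families equal and all weights 1 it counts pairs with equal
  labels, which is an additive energy when the labels are differences and a multiplicative one when
  they are ratios.\<close>

definition coincidence_sum ::
    "'i set \<Rightarrow> ('i \<Rightarrow> 'c) \<Rightarrow> ('i \<Rightarrow> real) \<Rightarrow> 'j set \<Rightarrow> ('j \<Rightarrow> 'c) \<Rightarrow> ('j \<Rightarrow> real) \<Rightarrow> real" where
  "coincidence_sum I u f J v g = (\<Sum>i\<in>I. \<Sum>j\<in>J. if u i = v j then f i * g j else 0)"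

text \<open>Over the set of labels the sum is an inner product of two vectors of fibre sums.
  Covering the labels of one family suffices, since a label missed by \<open>u\<close> has an empty
  fibre there.\<close>

lemma coincidence_sum_fibres:
  assumes "finite I" "finite J" "finite K" "u ` I \<subseteq> K"
  shows "coincidence_sum I u f J v g =
    (\<Sum>c\<in>K. (\<Sum>i | i \<in> I \<and> u i = c. f i) * (\<Sum>j | j \<in> J \<and> v j = c. g j))"
proof -
  have "(\<Sum>c\<in>K. (\<Sum>i | i \<in> I \<and> u i = c. f i) * (\<Sum>j | j \<in> J \<and> v j = c. g j))
      = (\<Sum>c\<in>K. \<Sum>i | i \<in> I \<and> u i = c. f i * (\<Sum>j | j \<in> J \<and> v j = u i. g j))"
    by (simp add: sum_distrib_right)
  also have "\<dots> = (\<Sum>i\<in>I. f i * (\<Sum>j | j \<in> J \<and> v j = u i. g j))"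
    by (rule sum.group) (use assms in auto)
  also have "\<dots> = coincidence_sum I u f J v g"
    unfolding coincidence_sum_def sum_distrib_left
    by (intro sum.cong refl sum.mono_neutral_cong_left) (use assms in auto)
  finally show ?thesis by simp
qed

lemma coincidence_sum_Cauchy_Schwarz:
  assumes "finite I" "finite J"
  shows "(coincidence_sum I u f J v g)\<^sup>2 \<le> coincidence_sum I u f I u f * coincidence_sum J v g J v g"
proof -
  define K where "K = u ` I \<union> v ` J"
  have K: "finite K" "u ` I \<subseteq> K" "v ` J \<subseteq> K" using assms by (auto simp: K_def)
  show ?thesis
    using Cauchy_Schwarz_ineq_sum
      [of "\<lambda>c. \<Sum>i | i \<in> I \<and> u i = c. f i" "\<lambda>c. \<Sum>j | j \<in> J \<and> v j = c. g j" K]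
    by (simp add: coincidence_sum_fibres[of _ _ K] assms K power2_eq_square)
qed

text \<open>Splitting each fibre sum along \<pi> into at most \<open>card E\<close> pieces and
  applying Cauchy-Schwarz to the pieces costs the factor \<open>card E\<close> and leaves only pairs
  that also agree in \<pi>.\<close>

lemma coincidence_sum_group_le:
  fixes f :: "'i \<Rightarrow> real"
  assumes "finite I" "finite E" "\<pi> ` I \<subseteq> E"
  shows "coincidence_sum I u f I u f
    \<le> card E * (\<Sum>i\<in>I. \<Sum>j\<in>I. if \<pi> i = \<pi> j \<and> u i = u j then f i * f j else 0)"
proof -
  define K where "K = u ` I"
  have K: "finite K" using assms by (auto simp: K_def)
  define F where "F c e = (\<Sum>i | i \<in> I \<and> u i = c \<and> \<pi> i = e. f i)" for c e
  have split: "(\<Sum>i | i \<in> I \<and> u i = c. f i) = (\<Sum>e\<in>E. F c e)" for c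
  proof -
    have "(\<Sum>e\<in>E. sum f {i. i \<in> {i. i \<in> I \<and> u i = c} \<and> \<pi> i = e}) = sum f {i. i \<in> I \<and> u i = c}"
      by (rule sum.group) (use assms in auto)
    then show ?thesis by (simp add: F_def conj_assoc)
  qed
  have "coincidence_sum I u f I u f = (\<Sum>c\<in>K. (\<Sum>e\<in>E. F c e)\<^sup>2)"
    by (subst coincidence_sum_fibres[of _ _ K]) (auto simp: assms K K_def split power2_eq_square)
  also have "\<dots> \<le> (\<Sum>c\<in>K. (\<Sum>e\<in>E. (F c e)\<^sup>2) * card E)"
    by (intro sum_mono sum_squared_le_sum_of_squares assms)
  also have "\<dots> = card E * (\<Sum>(c,e)\<in>K \<times> E. F c e * F c e)"
    by (simp add: sum_distrib_left sum.cartesian_product power2_eq_square mult.commute case_prod_unfold)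
  also have "(\<Sum>(c,e)\<in>K \<times> E. F c e * F c e)
      = coincidence_sum I (\<lambda>i. (u i, \<pi> i)) f I (\<lambda>i. (u i, \<pi> i)) f"
    by (subst coincidence_sum_fibres[of _ _ "K \<times> E"])
       (use assms K in \<open>auto simp: K_def F_def intro!: sum.cong\<close>)
  also have "\<dots> = (\<Sum>i\<in>I. \<Sum>j\<in>I. if \<pi> i = \<pi> j \<and> u i = u j then f i * f j else 0)"
    by (simp add: coincidence_sum_def conj_commute)
  finally show ?thesis .
qed

section \<open>Rich lines in a Cartesian product\<close>

text \<open>The pair \<open>l\<close> is (slope, intercept). Points are recorded by indices rather
  than coordinates, so that the grid can be cut into blocks of equal index length whatever the
  spacing of \<open>x\<close>.\<close>

definition line_points :: "(nat \<Rightarrow> real) \<Rightarrow> nat \<Rightarrow> real \<times> real \<Rightarrow> (nat \<times> nat) set" where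
  "line_points x N l = {(i, j). i < N \<and> j < N \<and> x j = fst l * x i + snd l}"

text \<open>Positive slope is what arises from ratios of positive differences, and it makes each
  line an increasing curve, on which the cell count below rests.\<close>

definition rich_lines :: "(nat \<Rightarrow> real) \<Rightarrow> nat \<Rightarrow> (real \<times> real) set" where
  "rich_lines x N =
     {l. 0 < fst l \<and> (\<exists>p\<in>line_points x N l. \<exists>q\<in>line_points x N l. p \<noteq> q)}"

definition cell :: "nat \<Rightarrow> nat \<times> nat \<Rightarrow> nat \<times> nat" where
  "cell t p = (fst p div t, snd p div t)"

lemma finite_line_points [simp]: "finite (line_points x N l)"
  by (rule finite_subset[of _ "{..<N} \<times> {..<N}"]) (auto simp: line_points_def)

lemma line_points_mono_iff:
  assumes "strict_mono x" "0 < fst l" "p \<in> line_points x N l" "q \<in> line_points x N l"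
  shows "fst p \<le> fst q \<longleftrightarrow> snd p \<le> snd q"
proof -
  have "x (fst p) \<le> x (fst q) \<longleftrightarrow> x (snd p) \<le> x (snd q)"
    using assms by (auto simp: line_points_def)
  then show ?thesis using assms(1) by (simp add: strict_mono_less_eq)
qed

lemma card_line_points_le:
  assumes "strict_mono x" "0 < fst l"
  shows "card (line_points x N l) \<le> N"
proof -
  have "inj_on fst (line_points x N l)"
  proof (rule inj_onI)
    fix p q assume "p \<in> line_points x N l" "q \<in> line_points x N l" "fst p = fst q"
    then show "p = q"
      using line_points_mono_iff[OF assms, of p N q] line_points_mono_iff[OF assms, of q N p]
      by (simp add: prod_eq_iff)
  qed
  moreover have "fst ` line_points x N l \<subseteq> {..<N}"
    by (auto simp: line_points_def)
  ultimately show ?thesis by (metis card_inj_on_le card_lessThan finite_lessThan)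
qed

text \<open>An increasing line visits the cells along a monotone staircase, so the sum of the two
  block coordinates identifies the cell; with both coordinates below \<open>R\<close> there are at
  most \<open>2 * R\<close> sums.\<close>

lemma card_cells_le:
  assumes "strict_mono x" "0 < fst l" "N \<le> R * t"
  shows "card (cell t ` line_points x N l) \<le> 2 * R"
proof -
  let ?S = "cell t ` line_points x N l"
  have inj: "inj_on (\<lambda>(b, c). b + c) ?S"
  proof (rule inj_onI)
    fix u v assume "u \<in> ?S" "v \<in> ?S" and eq: "(case u of (b, c) \<Rightarrow> b + c) = (case v of (b, c) \<Rightarrow> b + c)"
    then obtain p q where p: "p \<in> line_points x N l" "u = cell t p"
      and q: "q \<in> line_points x N l" "v = cell t q" by auto
    have "fst p \<le> fst q \<and> snd p \<le> snd q \<or> fst q \<le> fst p \<and> snd q \<le> snd p"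
      using line_points_mono_iff[OF assms(1,2) p(1) q(1)] line_points_mono_iff[OF assms(1,2) q(1) p(1)]
      by linarith
    then have "fst u \<le> fst v \<and> snd u \<le> snd v \<or> fst v \<le> fst u \<and> snd v \<le> snd u"
      unfolding p(2) q(2) cell_def by (auto intro: div_le_mono)
    with eq show "u = v" by (auto simp: case_prod_unfold prod_eq_iff)
  qed
  have "(\<lambda>(b, c). b + c) ` ?S \<subseteq> {..<2 * R}"
  proof clarsimp
    fix i j b c assume ij: "(i, j) \<in> line_points x N l" and c: "(b, c) = cell t (i, j)"
    have "i < R * t" "j < R * t" using ij assms(3) by (auto simp: line_points_def)
    then have "b < R" "c < R" using c by (auto simp: cell_def less_mult_imp_div_less)
    then show "b + c < 2 * R" by simp
  qed
  with inj show ?thesis by (metis card_inj_on_le card_lessThan finite_lessThan)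
qed

text \<open>Choose one representative for each value of \<open>c\<close>; every element that is not
  a representative collides with its own one.\<close>

lemma card_colliding_pairs_ge:
  assumes "finite S"
  shows "card S - card (c ` S) \<le> card {(p, q). p \<in> S \<and> q \<in> S \<and> p \<noteq> q \<and> c p = c q}"
proof -
  define rep where "rep = inv_into S c"
  have rep: "rep y \<in> S" "c (rep y) = y" if "y \<in> c ` S" for y
    using that by (auto simp: rep_def inv_into_into f_inv_into_f)
  have "card S - card (c ` S) \<le> card (S - rep ` c ` S)"
    using diff_card_le_card_Diff[of "rep ` c ` S" S] card_image_le[of "c ` S" rep] assms by auto
  also have "\<dots> \<le> card {(p, q). p \<in> S \<and> q \<in> S \<and> p \<noteq> q \<and> c p = c q}"
  proof (rule card_inj_on_le)
    show "inj_on (\<lambda>p. (p, rep (c p))) (S - rep ` c ` S)" by (auto simp: inj_on_def)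
    show "(\<lambda>p. (p, rep (c p))) ` (S - rep ` c ` S) \<subseteq> {(p, q). p \<in> S \<and> q \<in> S \<and> p \<noteq> q \<and> c p = c q}"
      using rep by auto
    show "finite {(p, q). p \<in> S \<and> q \<in> S \<and> p \<noteq> q \<and> c p = c q}"
      by (rule finite_subset[of _ "S \<times> S"]) (use assms in auto)
  qed
  finally show ?thesis .
qed

text \<open>The positive slope excludes vertical pairs, so slope and intercept can be recovered.
  This bounds the number of lines and keeps the pair counts of different lines disjoint.\<close>

lemma line_through_two_points:
  assumes "strict_mono x" "0 < fst l" "p \<in> line_points x N l" "q \<in> line_points x N l" "p \<noteq> q"
  shows "l = (let m = (x (snd q) - x (snd p)) / (x (fst q) - x (fst p)) in (m, x (snd p) - m * x (fst p)))"
proof -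
  have "fst p \<noteq> fst q"
    using line_points_mono_iff[OF assms(1,2,3,4)] line_points_mono_iff[OF assms(1,2,4,3)] assms(5)
    by (auto simp: prod_eq_iff)
  then have "x (fst q) - x (fst p) \<noteq> 0" using assms(1) by (simp add: strict_mono_eq)
  moreover have "x (snd q) - x (snd p) = fst l * (x (fst q) - x (fst p))"
    using assms by (auto simp: line_points_def algebra_simps)
  ultimately have "(x (snd q) - x (snd p)) / (x (fst q) - x (fst p)) = fst l" by simp
  moreover have "x (snd p) - fst l * x (fst p) = snd l"
    using assms by (auto simp: line_points_def)
  ultimately show ?thesis by (simp add: Let_def)
qed

text \<open>A line is determined by two of the \<open>N^2\<close> grid points. The crude count only
  has to absorb the lines with fewer than four points.\<close>

lemma rich_lines_bound:
  assumes "strict_mono x"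
  shows "finite (rich_lines x N)" "card (rich_lines x N) \<le> N ^ 4"
proof -
  define f where "f = (\<lambda>(p, q). let m = (x (snd q) - x (snd p)) / (x (fst q) - x (fst p))
                                in (m, x (snd p) - m * x (fst p)))"
  define D where "D = ({..<N} \<times> {..<N}) \<times> ({..<N} \<times> {..<N})"
  have D: "finite D" "card D = N ^ 4" by (auto simp: D_def power4_eq_xxxx)
  have sub: "rich_lines x N \<subseteq> f ` D"
  proof
    fix l assume "l \<in> rich_lines x N"
    then obtain p q where pq: "0 < fst l" "p \<in> line_points x N l" "q \<in> line_points x N l" "p \<noteq> q"
      by (auto simp: rich_lines_def)
    then have "l = f (p, q)" unfolding f_def prod.case by (rule line_through_two_points[OF assms])
    moreover have "(p, q) \<in> D" using pq by (auto simp: D_def line_points_def)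
    ultimately show "l \<in> f ` D" by blast
  qed
  show "finite (rich_lines x N)" by (rule finite_subset[OF sub]) (simp add: D)
  show "card (rich_lines x N) \<le> N ^ 4"
    using card_mono[OF _ sub] card_image_le[OF D(1), of f] D by auto
qed

text \<open>Given \<open>i\<close>, a partner in the same block is determined by its residue modulo
  \<open>t\<close>.\<close>

lemma card_same_block_le:
  assumes "t > 0"
  shows "card {(i, i'). i < N \<and> i' < N \<and> i div t = i' div (t::nat)} \<le> N * t"
proof -
  have "card {(i, i'). i < N \<and> i' < N \<and> i div t = i' div t} \<le> card ({..<N} \<times> {..<t})"
  proof (rule card_inj_on_le)
    show "inj_on (\<lambda>(i, i'). (i, i' mod t)) {(i, i'). i < N \<and> i' < N \<and> i div t = i' div t}"
      by (auto simp: inj_on_def) (metis div_mult_mod_eq)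
  qed (use assms in auto)
  then show ?thesis by simp
qed

text \<open>Two distinct points determine their line, so the pairs of points sharing a cell are counted for
  at most one line; a line with more than \<open>2R\<close> points must have such pairs because it meets at most
  \<open>2R\<close> cells.\<close>

lemma sum_line_excess_le:
  assumes "strict_mono x" "N \<le> R * t" "t > 0"
  shows "(\<Sum>l\<in>rich_lines x N. card (line_points x N l) - 2 * R) \<le> N\<^sup>2 * t\<^sup>2"
proof -
  define B where "B l = {(p, q). p \<in> line_points x N l \<and> q \<in> line_points x N l \<and> p \<noteq> q \<and> cell t p = cell t q}" for l
  define S where "S = {(i, i'). i < N \<and> i' < N \<and> i div t = i' div t}"
  have finS: "finite S" by (rule finite_subset[of _ "{..<N} \<times> {..<N}"]) (auto simp: S_def)
  have finB: "finite (B l)" for l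
    by (rule finite_subset[of _ "line_points x N l \<times> line_points x N l"]) (auto simp: B_def)
  have pos: "0 < fst l" if "l \<in> rich_lines x N" for l using that by (auto simp: rich_lines_def)
  have "(\<Sum>l\<in>rich_lines x N. card (line_points x N l) - 2 * R) \<le> (\<Sum>l\<in>rich_lines x N. card (B l))"
  proof (rule sum_mono)
    fix l assume "l \<in> rich_lines x N"
    then show "card (line_points x N l) - 2 * R \<le> card (B l)"
      using card_cells_le[OF assms(1) pos assms(2), of l]
        card_colliding_pairs_ge[OF finite_line_points, of x N l "cell t"]
      unfolding B_def by linarith
  qed
  also have "\<dots> = card (\<Union>l\<in>rich_lines x N. B l)"
  proof (rule card_UN_disjoint[symmetric])
    show "\<forall>l\<in>rich_lines x N. \<forall>l'\<in>rich_lines x N. l \<noteq> l' \<longrightarrow> B l \<inter> B l' = {}"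
    proof (intro ballI impI)
      fix l l' assume l: "l \<in> rich_lines x N" "l' \<in> rich_lines x N" "l \<noteq> l'"
      have False if "(p, q) \<in> B l" "(p, q) \<in> B l'" for p q
      proof -
        have "p \<in> line_points x N l" "q \<in> line_points x N l" "p \<in> line_points x N l'"
          "q \<in> line_points x N l'" "p \<noteq> q"
          using that by (auto simp: B_def)
        then show False
          using l(3) line_through_two_points[OF assms(1) pos[OF l(1)], of p N q]
            line_through_two_points[OF assms(1) pos[OF l(2)], of p N q] by simp
      qed
      then show "B l \<inter> B l' = {}" by auto
    qed
  qed (use rich_lines_bound[OF assms(1)] finB in auto)
  \<comment> \<open>Two points share a cell exactly when their first indices share a block and so do
    their second ones, so regrouping the coordinates lands in two independent same-block
    counts.\<close>
  also have "\<dots> \<le> card (S \<times> S)"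
  proof (rule card_inj_on_le)
    show "inj_on (\<lambda>((i, j), (i', j')). ((i, i'), (j, j'))) (\<Union>l\<in>rich_lines x N. B l)"
      by (rule inj_onI) (simp add: case_prod_unfold prod_eq_iff)
    show "(\<lambda>((i, j), (i', j')). ((i, i'), (j, j'))) ` (\<Union>l\<in>rich_lines x N. B l) \<subseteq> S \<times> S"
      by (auto simp: B_def S_def line_points_def cell_def)
  qed (use finS in auto)
  also have "\<dots> \<le> (N * t) * (N * t)"
    unfolding card_cartesian_product S_def using card_same_block_le[OF assms(3)] by (intro mult_mono) auto
  finally show ?thesis by (simp add: power2_eq_square mult_ac)
qed

text \<open>The cells are chosen so that the excess over \<open>2 * R\<close> is at least half of
  the points. A cube is then \<open>O(R^2)\<close> times an excess, and in the bound for the total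
  excess the factors \<open>R^2\<close> and \<open>t^2\<close> combine to \<open>O(N^2)\<close>,
  independently of \<open>j\<close>.\<close>

lemma sum_cubes_dyadic_lines_le:
  assumes "strict_mono x" "2 \<le> j" "2 ^ j \<le> N"
  shows "(\<Sum>l\<in>rich_lines x N. if 2 ^ j \<le> card (line_points x N l) \<and> card (line_points x N l) < 2 ^ Suc j
           then card (line_points x N l) ^ 3 else 0) \<le> 512 * N ^ 4"
proof -
  \<comment> \<open>A quarter of the lower end \<open>2 ^ j\<close>, so that \<open>2 * R\<close> is
    at most half the number of points on the line.\<close>
  define R :: nat where "R = 2 ^ (j - 2)"
  \<comment> \<open>The added 1 makes \<open>R\<close> blocks of length \<open>t\<close> cover all
    \<open>N\<close> indices, while \<open>R <= N\<close> keeps \<open>R * t\<close> at most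
    \<open>2 * N\<close>.\<close>
  define t where "t = N div R + 1"
  obtain i where "j = 2 + i" using assms(2) le_Suc_ex by blast
  then have R: "2 ^ j = 4 * R" "R > 0" by (simp_all add: R_def)
  have "R * t = N div R * R + R" by (simp add: t_def algebra_simps)
  then have "N \<le> R * t" "R * t \<le> N + R"
    using div_mult_mod_eq[of N R] mod_less_divisor[OF R(2), of N] by linarith+
  then have Rt: "N \<le> R * t" "R * t \<le> 2 * N" using R assms(3) by linarith+
  let ?k = "\<lambda>l. card (line_points x N l)"
  have "(\<Sum>l\<in>rich_lines x N. if 2 ^ j \<le> ?k l \<and> ?k l < 2 ^ Suc j then ?k l ^ 3 else 0)
      \<le> (\<Sum>l\<in>rich_lines x N. 128 * R\<^sup>2 * (?k l - 2 * R))"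
  proof (rule sum_mono)
    fix l
    show "(if 2 ^ j \<le> ?k l \<and> ?k l < 2 ^ Suc j then ?k l ^ 3 else 0) \<le> 128 * R\<^sup>2 * (?k l - 2 * R)"
    proof (cases "2 ^ j \<le> ?k l \<and> ?k l < 2 ^ Suc j")
      case True
      then have k: "4 * R \<le> ?k l" "?k l \<le> 8 * R" using R by auto
      have "?k l ^ 3 = (?k l)\<^sup>2 * ?k l" by (simp add: power2_eq_square power3_eq_cube)
      also have "\<dots> \<le> (8 * R)\<^sup>2 * (2 * (?k l - 2 * R))"
        using k by (intro mult_mono power_mono) auto
      finally show ?thesis using True by (simp add: power_mult_distrib)
    qed auto
  qed
  also have "\<dots> \<le> 128 * R\<^sup>2 * (N\<^sup>2 * t\<^sup>2)"
    unfolding sum_distrib_left[symmetric]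
    by (intro mult_left_mono sum_line_excess_le[OF assms(1) Rt(1)]) (auto simp: t_def)
  also have "\<dots> = 128 * N\<^sup>2 * (R * t)\<^sup>2" by (simp add: power_mult_distrib)
  also have "\<dots> \<le> 128 * N\<^sup>2 * (2 * N)\<^sup>2" using Rt by (intro mult_left_mono power_mono) auto
  also have "\<dots> = 512 * N ^ 4" by (simp add: power_mult_distrib power2_eq_square power4_eq_xxxx)
  finally show ?thesis .
qed

text \<open>Dyadic decomposition by line size: about \<open>log N\<close> ranges contribute
  \<open>O(N^4)\<close> each, and a line with fewer than four points contributes at most 64.\<close>

lemma sum_cubes_lines_le:
  assumes "strict_mono x" "2 ^ J \<le> N" "N < 2 ^ Suc J"
  shows "(\<Sum>l\<in>rich_lines x N. card (line_points x N l) ^ 3) \<le> 512 * N ^ 4 * (J + 1)"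
proof -
  let ?k = "\<lambda>l. card (line_points x N l)"
  let ?d = "\<lambda>l j. if 2 ^ j \<le> ?k l \<and> ?k l < 2 ^ Suc j then ?k l ^ 3 else 0"
  have "(\<Sum>l\<in>rich_lines x N. ?k l ^ 3) \<le> (\<Sum>l\<in>rich_lines x N. 64 + (\<Sum>j\<in>{2..J}. ?d l j))"
  proof (rule sum_mono)
    fix l assume "l \<in> rich_lines x N"
    then have kN: "?k l \<le> N" using card_line_points_le[OF assms(1)] by (auto simp: rich_lines_def)
    show "?k l ^ 3 \<le> 64 + (\<Sum>j\<in>{2..J}. ?d l j)"
    proof (cases "?k l < 4")
      case True
      then have "?k l ^ 3 \<le> 4 ^ 3" by (intro power_mono) auto
      then show ?thesis by simp
    next
      case False
      then obtain j where j: "2 ^ j \<le> ?k l" "?k l < 2 ^ Suc j"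
        using ex_power_ivl1[of 2 "?k l"] by auto
      have "j \<le> J"
      proof (rule ccontr)
        assume "\<not> j \<le> J"
        then have "(2::nat) ^ Suc J \<le> 2 ^ j" by (intro power_increasing) auto
        with j kN assms(3) show False by linarith
      qed
      moreover have "2 \<le> j"
      proof (rule ccontr)
        assume "\<not> 2 \<le> j"
        then have "(2::nat) ^ Suc j \<le> 2 ^ 2" by (intro power_increasing) auto
        with j False show False by simp
      qed
      ultimately have "?d l j \<le> (\<Sum>j\<in>{2..J}. ?d l j)" by (intro member_le_sum) auto
      with j show ?thesis by simp
    qed
  qed
  also have "\<dots> = 64 * card (rich_lines x N) + (\<Sum>j\<in>{2..J}. \<Sum>l\<in>rich_lines x N. ?d l j)"
    by (subst sum.swap) (simp add: sum.distrib)
  also have "\<dots> \<le> 64 * N ^ 4 + (\<Sum>j\<in>{2..J}. 512 * N ^ 4)"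
  proof (intro add_mono mult_left_mono sum_mono)
    fix j assume "j \<in> {2..J}"
    moreover from this have "(2::nat) ^ j \<le> 2 ^ J" by (intro power_increasing) auto
    ultimately show "(\<Sum>l\<in>rich_lines x N. ?d l j) \<le> 512 * N ^ 4"
      using le_trans[OF _ assms(2)] by (intro sum_cubes_dyadic_lines_le[OF assms(1)]) auto
  qed (use rich_lines_bound[OF assms(1)] in auto)
  also have "\<dots> = 64 * N ^ 4 + 512 * N ^ 4 * (J - 1)" by simp
  also have "\<dots> \<le> 512 * N ^ 4 + 512 * N ^ 4 * J" by (intro add_mono mult_left_mono) auto
  finally show ?thesis by (simp add: algebra_simps)
qed

section \<open>Multiplicative energy of differences\<close>

lemma sum_indicator_eq_card:
  assumes "finite I" "finite J"
  shows "(\<Sum>i\<in>I. \<Sum>j\<in>J. if Q i j then 1 else 0) = real (card {(i, j). i \<in> I \<and> j \<in> J \<and> Q i j})"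
proof -
  have "(\<Sum>i\<in>I. \<Sum>j\<in>J. if Q i j then 1 else (0::real)) = (\<Sum>z\<in>I \<times> J. if Q (fst z) (snd z) then 1 else 0)"
    by (simp add: sum.cartesian_product case_prod_unfold)
  also have "\<dots> = card {z \<in> I \<times> J. Q (fst z) (snd z)}"
    using assms by (simp flip: sum.inter_filter)
  also have "{z \<in> I \<times> J. Q (fst z) (snd z)} = {(i, j). i \<in> I \<and> j \<in> J \<and> Q i j}" by auto
  finally show ?thesis .
qed

text \<open>One order of each pair of distinct indices, so that the differences of an increasing
  sequence are positive.\<close>

definition descending_pairs :: "nat \<Rightarrow> (nat \<times> nat) set" where
  "descending_pairs N = {(i, j). j < i \<and> i < N}"

lemma finite_descending_pairs [simp]: "finite (descending_pairs N)"
  by (rule finite_subset[of _ "{..<N} \<times> {..<N}"]) (auto simp: descending_pairs_def)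

text \<open>Fixing the larger indices \<open>e\<close>, \<open>f\<close> of the two differences
  costs a factor \<open>N^2\<close>. Ratios that agree for the same \<open>e\<close>,
  \<open>f\<close> mean that \<open>(e, f)\<close>, \<open>(b, c)\<close> and
  \<open>(b', c')\<close> lie on one line of positive slope, so what remains is at most the sum of
  the cubes of the line sizes.\<close>

lemma multiplicative_energy_le:
  fixes x :: "nat \<Rightarrow> real"
  assumes x: "strict_mono x" and N: "2 ^ J \<le> N" "N < 2 ^ Suc J"
  defines "P \<equiv> descending_pairs N"
    and "u \<equiv> \<lambda>(p, q). (x (fst q) - x (snd q)) / (x (fst p) - x (snd p))"
  shows "coincidence_sum (P \<times> P) u (\<lambda>_. 1) (P \<times> P) u (\<lambda>_. 1) \<le> 512 * real N ^ 6 * (J + 1)"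
proof -
  define \<pi> :: "(nat \<times> nat) \<times> (nat \<times> nat) \<Rightarrow> nat \<times> nat" where "\<pi> = (\<lambda>(p, q). (fst p, fst q))"
  define T where "T = {(i, j). i \<in> P \<times> P \<and> j \<in> P \<times> P \<and> \<pi> i = \<pi> j \<and> u i = u j}"
  define U where "U = (\<Union>l\<in>rich_lines x N. line_points x N l \<times> line_points x N l \<times> line_points x N l)"
  have fin: "finite (P \<times> P)" by (simp add: P_def)
  have finU: "finite U" unfolding U_def using rich_lines_bound[OF x] by auto
  have "card T \<le> card U"
  proof (rule card_inj_on_le)
    \<comment> \<open>The upper point is recorded once, followed by the two lower points; nothing is
      lost on \<open>T\<close>, where both quadruples have the same upper point.\<close>
    let ?f = "\<lambda>(i, j). (\<pi> i, (snd (fst i), snd (snd i)), (snd (fst j), snd (snd j)))"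
    show "inj_on ?f T"
      by (rule inj_onI) (auto simp: T_def \<pi>_def)
    show "?f ` T \<subseteq> U"
    proof (rule image_subsetI)
      fix z assume z: "z \<in> T"
      obtain e b f c e' b' f' c' where z': "z = (((e, b), (f, c)), ((e', b'), (f', c')))"
        by (metis surj_pair)
      from z have ord: "b < e" "e < N" "c < f" "f < N" "b' < e" "c' < f" "e' = e" "f' = f"
        and ueq: "(x f - x c) / (x e - x b) = (x f - x c') / (x e - x b')"
        by (auto simp: z' T_def P_def descending_pairs_def \<pi>_def u_def)
      define m where "m = (x f - x c) / (x e - x b)"
      have pos: "x f - x c > 0" "x e - x b > 0" "x e - x b' > 0"
        using ord x by (auto simp: strict_mono_less)
      have m1: "x f - x c = m * (x e - x b)" using pos by (simp add: m_def)
      have m2: "x f - x c' = m * (x e - x b')" using pos unfolding m_def ueq by simp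
      define l where "l = (m, x f - m * x e)"
      have pts: "(e, f) \<in> line_points x N l" "(b, c) \<in> line_points x N l" "(b', c') \<in> line_points x N l"
        using ord m1 m2 by (auto simp: line_points_def l_def algebra_simps)
      have "m > 0" using pos by (simp add: m_def)
      moreover have "(e, f) \<noteq> (b, c)" using ord by auto
      ultimately have "l \<in> rich_lines x N"
        using pts(1,2) unfolding rich_lines_def by (metis (mono_tags, lifting) fst_conv l_def mem_Collect_eq)
      with pts show "?f z \<in> U" by (auto simp: z' \<pi>_def U_def)
    qed
  qed (rule finU)
  also have "\<dots> \<le> (\<Sum>l\<in>rich_lines x N. card (line_points x N l \<times> line_points x N l \<times> line_points x N l))"
    unfolding U_def using rich_lines_bound[OF x] by (intro card_UN_le)
  also have "\<dots> = (\<Sum>l\<in>rich_lines x N. card (line_points x N l) ^ 3)"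
    by (simp add: card_cartesian_product power3_eq_cube mult.assoc)
  also have "\<dots> \<le> 512 * N ^ 4 * (J + 1)"
    by (rule sum_cubes_lines_le[OF x N])
  finally have T: "real (card T) \<le> real (512 * N ^ 4 * (J + 1))" by (rule of_nat_mono)
  have "coincidence_sum (P \<times> P) u (\<lambda>_. 1) (P \<times> P) u (\<lambda>_. 1)
      \<le> real (card ({..<N} \<times> {..<N})) *
        (\<Sum>i\<in>P \<times> P. \<Sum>j\<in>P \<times> P. if \<pi> i = \<pi> j \<and> u i = u j then 1 * 1 else 0)"
    by (rule coincidence_sum_group_le[OF fin])
       (auto simp: \<pi>_def P_def descending_pairs_def)
  also have "\<dots> = real N ^ 2 * card T"
    unfolding T_def mult_1_left sum_indicator_eq_card[OF fin fin] by (simp add: power2_eq_square)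
  also have "\<dots> \<le> real N ^ 2 * real (512 * N ^ 4 * (J + 1))"
    by (intro mult_left_mono T) auto
  also have "\<dots> = 512 * real N ^ 6 * (J + 1)"
    by (simp add: algebra_simps flip: power_add)
  finally show ?thesis .
qed

section \<open>GCD sums\<close>

definition num_divisors :: "nat \<Rightarrow> nat" where
  "num_divisors n = card {d. d dvd n}"

lemma num_divisors_mult_le:
  assumes "m > 0" "n > 0"
  shows "num_divisors (m * n) \<le> num_divisors m * num_divisors n"
proof -
  have "{d. d dvd m * n} \<subseteq> (\<lambda>(x, y). x * y) ` ({d. d dvd m} \<times> {d. d dvd n})"
  proof
    fix d assume "d \<in> {d. d dvd m * n}"
    then obtain b c where "d = b * c" "b dvd m" "c dvd n" using division_decomp[of d m n] by auto
    then show "d \<in> (\<lambda>(x, y). x * y) ` ({d. d dvd m} \<times> {d. d dvd n})" by force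
  qed
  then have "num_divisors (m * n) \<le> card ({d. d dvd m} \<times> {d. d dvd n})"
    unfolding num_divisors_def using assms
    by (intro surj_card_le) auto
  then show ?thesis by (simp add: num_divisors_def card_cartesian_product)
qed

text \<open>Induction on the exponent: writing one factor \<open>num_divisors n\<close> as a sum
  over factorizations \<open>n = c * e\<close> and using submultiplicativity for the others bounds
  the sum by the square of the previous one, which doubles the power of
  \<open>harm Y\<close>.\<close>

lemma sum_num_divisors_power_le:
  "(\<Sum>n\<in>{1..Y}. real (num_divisors n) ^ j / real n) \<le> (harm Y :: real) ^ (2 ^ j)"
proof (induction j)
  case 0
  show ?case by (simp add: harm_def inverse_eq_divide)
next
  case (Suc j)
  let ?f = "\<lambda>n. real (num_divisors n) ^ j / real n"
  have "(\<Sum>n\<in>{1..Y}. real (num_divisors n) ^ Suc j / real n) = (\<Sum>n\<in>{1..Y}. \<Sum>c\<in>{c. c dvd n}. ?f n)"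
    by (simp add: num_divisors_def)
  also have "\<dots> = (\<Sum>(n, c)\<in>(SIGMA n:{1..Y}. {c. c dvd n}). ?f n)"
    by (intro sum.Sigma) auto
  \<comment> \<open>Relaxing \<open>c * e <= Y\<close> to both factors being at most
    \<open>Y\<close> adds only nonnegative terms and prepares the factorization.\<close>
  also have "\<dots> \<le> (\<Sum>(c, e)\<in>{1..Y} \<times> {1..Y}. ?f (c * e))"
  proof (rule sum_le_included[where i = "\<lambda>(c, e). (c * e, c)"])
    show "\<forall>z\<in>(SIGMA n:{1..Y}. {c. c dvd n}). \<exists>w\<in>{1..Y} \<times> {1..Y}.
        (case w of (c, e) \<Rightarrow> (c * e, c)) = z \<and> (case z of (n, c) \<Rightarrow> ?f n) \<le> (case w of (c, e) \<Rightarrow> ?f (c * e))"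
    proof
      fix z assume "z \<in> (SIGMA n:{1..Y}. {c. c dvd n})"
      then obtain c e where z: "z = (c * e, c)" "1 \<le> c * e" "c * e \<le> Y" by (auto elim!: dvdE)
      then have "0 < c" "0 < e" by auto
      moreover have "c \<le> c * e" "e \<le> c * e" using \<open>0 < c\<close> \<open>0 < e\<close> by auto
      then have "c \<le> Y" "e \<le> Y" using z(3) by linarith+
      ultimately show "\<exists>w\<in>{1..Y} \<times> {1..Y}.
        (case w of (c, e) \<Rightarrow> (c * e, c)) = z \<and> (case z of (n, c) \<Rightarrow> ?f n) \<le> (case w of (c, e) \<Rightarrow> ?f (c * e))"
        by (intro bexI[of _ "(c, e)"]) (auto simp: z(1))
    qed
  qed (auto intro: finite_SigmaI)
  also have "\<dots> \<le> (\<Sum>(c, e)\<in>{1..Y} \<times> {1..Y}. ?f c * ?f e)"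
  proof (rule sum_mono)
    fix z assume "z \<in> {1..Y} \<times> {1..Y}"
    then obtain c e where z: "z = (c, e)" "c > 0" "e > 0" by auto
    have "real (num_divisors (c * e)) ^ j \<le> (real (num_divisors c) * real (num_divisors e)) ^ j"
      using num_divisors_mult_le[OF z(2,3)] by (intro power_mono) (auto simp flip: of_nat_mult)
    then show "(case z of (c, e) \<Rightarrow> ?f (c * e)) \<le> (case z of (c, e) \<Rightarrow> ?f c * ?f e)"
      by (auto simp: z power_mult_distrib intro!: divide_right_mono)
  qed
  also have "\<dots> = (\<Sum>n\<in>{1..Y}. ?f n) * (\<Sum>n\<in>{1..Y}. ?f n)"
    by (simp add: sum_product sum.cartesian_product)
  also have "\<dots> \<le> harm Y ^ (2 ^ j) * harm Y ^ (2 ^ j)"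
    by (intro mult_mono Suc sum_nonneg) (auto simp: harm_nonneg)
  finally show ?case by (simp add: power_add[symmetric] mult_2)
qed

text \<open>Three of the factors are divisors of \<open>n\<close> and determine the fourth.\<close>

lemma card_four_factorizations_le:
  assumes "n > 0"
  shows "card {(b1, b2, b3, b4). b1 * b2 * b3 * b4 = n} \<le> num_divisors n ^ 3"
    and "finite {(b1, b2, b3, b4). b1 * b2 * b3 * b4 = n}"
proof -
  let ?D = "{d. d dvd n}" and ?S = "{(b1, b2, b3, b4). b1 * b2 * b3 * b4 = n}"
  let ?f = "\<lambda>(b1, b2, b3, b4 :: nat). (b1, b2, b3 :: nat)"
  have inj: "inj_on ?f ?S" using assms by (auto simp: inj_on_def)
  have sub: "?f ` ?S \<subseteq> ?D \<times> ?D \<times> ?D" by auto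
  have fin: "finite (?D \<times> ?D \<times> ?D)" using assms by auto
  show "finite ?S" using inj_on_finite[OF inj sub fin] .
  show "card ?S \<le> num_divisors n ^ 3"
    using card_inj_on_le[OF inj sub fin]
    by (simp add: num_divisors_def card_cartesian_product power3_eq_cube mult.assoc)
qed

text \<open>For fixed \<open>a\<close> there are at most \<open>num_divisors (m a) ^ 3\<close>
  matching \<open>b\<close>. Submultiplicativity then factorizes the sum into the fourth power of a
  third divisor moment, itself at most \<open>harm Y ^ 8\<close>, whence the exponent 32.\<close>

lemma sum_four_products_le:
  fixes Y :: nat
  defines "T \<equiv> {1..Y} \<times> {1..Y} \<times> {1..Y} \<times> {1..Y}"
    and "m \<equiv> \<lambda>(a1, a2, a3, a4). a1 * a2 * a3 * (a4 :: nat)"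
  shows "(\<Sum>a\<in>T. \<Sum>b\<in>T. if m a = m b then 1 / real (m a) else 0) \<le> harm Y ^ 32"
proof -
  have "(\<Sum>a\<in>T. \<Sum>b\<in>T. if m a = m b then 1 / real (m a) else 0)
      \<le> (\<Sum>a\<in>T. real (num_divisors (m a)) ^ 3 / real (m a))"
  proof (rule sum_mono)
    fix a assume "a \<in> T"
    then have ma: "m a > 0" by (auto simp: T_def m_def)
    have finT: "finite T" by (simp add: T_def)
    have "(\<Sum>b\<in>T. if m a = m b then c else 0) = card {b \<in> T. m a = m b} * c" for c :: real
      by (subst sum.inter_filter[OF finT, symmetric]) (simp cong: sum.cong)
    then have "(\<Sum>b\<in>T. if m a = m b then 1 / real (m a) else 0) = card {b \<in> T. m a = m b} / real (m a)"
      by simp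
    also have "card {b \<in> T. m a = m b} \<le> card {(b1, b2, b3, b4). b1 * b2 * b3 * b4 = m a}"
      by (intro card_mono card_four_factorizations_le(2) ma) (auto simp: m_def)
    also have "\<dots> \<le> num_divisors (m a) ^ 3" by (rule card_four_factorizations_le(1)[OF ma])
    finally show "(\<Sum>b\<in>T. if m a = m b then 1 / real (m a) else 0) \<le> real (num_divisors (m a)) ^ 3 / real (m a)"
      by (simp add: divide_right_mono)
  qed
  also have "\<dots> \<le> (\<Sum>(a1, a2, a3, a4)\<in>T. (real (num_divisors a1) ^ 3 / real a1) * ((real (num_divisors a2) ^ 3 / real a2)
      * ((real (num_divisors a3) ^ 3 / real a3) * (real (num_divisors a4) ^ 3 / real a4))))"
  proof (rule sum_mono)
    fix a assume "a \<in> T"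
    then obtain a1 a2 a3 a4 where a: "a = (a1, a2, a3, a4)" "a1 > 0" "a2 > 0" "a3 > 0" "a4 > 0"
      by (auto simp: T_def)
    have "num_divisors (m a) \<le> num_divisors (a1 * a2 * a3) * num_divisors a4"
      unfolding a m_def by (simp add: num_divisors_mult_le a)
    also have "\<dots> \<le> num_divisors (a1 * a2) * num_divisors a3 * num_divisors a4"
      by (intro mult_right_mono num_divisors_mult_le) (use a in auto)
    also have "\<dots> \<le> num_divisors a1 * num_divisors a2 * num_divisors a3 * num_divisors a4"
      by (intro mult_right_mono num_divisors_mult_le) (use a in auto)
    finally have "real (num_divisors (m a)) ^ 3
        \<le> (real (num_divisors a1) * real (num_divisors a2) * real (num_divisors a3) * real (num_divisors a4)) ^ 3"
      by (intro power_mono) (auto simp flip: of_nat_mult)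
    then have "real (num_divisors (m a)) ^ 3 / real (m a)
        \<le> (real (num_divisors a1) * real (num_divisors a2) * real (num_divisors a3) * real (num_divisors a4)) ^ 3 / real (m a)"
      by (rule divide_right_mono) simp
    then show "real (num_divisors (m a)) ^ 3 / real (m a) \<le> (case a of (a1, a2, a3, a4) \<Rightarrow>
        (real (num_divisors a1) ^ 3 / real a1) * ((real (num_divisors a2) ^ 3 / real a2)
      * ((real (num_divisors a3) ^ 3 / real a3) * (real (num_divisors a4) ^ 3 / real a4))))"
      by (simp add: a m_def power_mult_distrib mult_ac)
  qed
  also have "\<dots> = (\<Sum>n\<in>{1..Y}. real (num_divisors n) ^ 3 / real n) ^ 4"
    unfolding T_def
    by (simp only: sum.cartesian_product[symmetric] sum_distrib_left[symmetric] sum_distrib_right[symmetric]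
         power4_eq_xxxx mult.assoc)
  also have "\<dots> \<le> (harm Y ^ (2 ^ 3)) ^ 4"
    by (intro power_mono sum_num_divisors_power_le sum_nonneg) auto
  finally show ?thesis by (simp flip: power_mult)
qed

lemma coincidence_sum_nonneg:
  assumes "\<And>i. i \<in> I \<Longrightarrow> 0 \<le> f i" "\<And>j. j \<in> J \<Longrightarrow> 0 \<le> g j"
  shows "0 \<le> coincidence_sum I u f J v g"
  unfolding coincidence_sum_def by (intro sum_nonneg) (auto intro!: sum_nonneg simp: assms)

text \<open>Coprimality of \<open>h\<close> and \<open>k\<close> is not imposed: the extra terms are nonnegative, and the sum over all
  \<open>h, k\<close> factorizes after Cauchy-Schwarz.\<close>

definition dilation_sum :: "'p set \<Rightarrow> ('p \<Rightarrow> real) \<Rightarrow> nat \<Rightarrow> real" where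
  "dilation_sum P d Y = coincidence_sum P d (\<lambda>_. 1) (P \<times> {1..Y} \<times> {1..Y})
     (\<lambda>(q, h, k). d q * real h / real k) (\<lambda>(q, h, k). 1 / sqrt (real h * real k))"

text \<open>Clearing denominators turns equality of two ratios into
  \<open>h1 * k2 * k3 * h4 = k1 * h2 * h3 * k4\<close>, an equality of fourfold products. The
  weight, the inverse square root of the product of both sides, becomes the inverse of their common
  value.\<close>

lemma dilation_weights_le:
  fixes Y :: nat
  defines "Z \<equiv> ({1..Y} \<times> {1..Y}) \<times> ({1..Y} \<times> {1..Y})"
    and "u \<equiv> \<lambda>((h, k), (h', k')). (real h * real k') / (real k * real h')"
    and "w \<equiv> \<lambda>((h, k), (h', k')). 1 / sqrt (real h * real k) * (1 / sqrt (real h' * real k'))"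
  shows "coincidence_sum Z u w Z u w \<le> harm Y ^ 32"
proof -
  define T where "T = {1..Y} \<times> {1..Y} \<times> {1..Y} \<times> {1..Y}"
  define m where "m = (\<lambda>(a1, a2, a3, a4). a1 * a2 * a3 * (a4 :: nat))"
  have "coincidence_sum Z u w Z u w = (\<Sum>(i, j)\<in>Z \<times> Z. if u i = u j then w i * w j else 0)"
    by (simp add: coincidence_sum_def sum.cartesian_product)
  also have "\<dots> = (\<Sum>(a, b)\<in>T \<times> T. if m a = m b then 1 / real (m a) else 0)"
  proof (rule sum.reindex_bij_witness
      [where j = "\<lambda>(((h1, k1), (h2, k2)), ((h3, k3), (h4, k4))). ((h1, k2, k3, h4), (k1, h2, h3, k4))"
         and i = "\<lambda>((h1, k2, k3, h4), (k1, h2, h3, k4)). (((h1, k1), (h2, k2)), ((h3, k3), (h4, k4)))"])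
    fix z assume "z \<in> Z \<times> Z"
    then obtain h1 k1 h2 k2 h3 k3 h4 k4 where z: "z = (((h1, k1), (h2, k2)), ((h3, k3), (h4, k4)))"
      and pos: "h1 > 0" "k1 > 0" "h2 > 0" "k2 > 0" "h3 > 0" "k3 > 0" "h4 > 0" "k4 > 0"
      by (auto simp: Z_def)
    have eq: "u ((h1, k1), (h2, k2)) = u ((h3, k3), (h4, k4)) \<longleftrightarrow> h1 * k2 * k3 * h4 = k1 * h2 * h3 * k4"
    proof -
      have "u ((h1, k1), (h2, k2)) = u ((h3, k3), (h4, k4)) \<longleftrightarrow>
          real (h1 * k2 * k3 * h4) = real (k1 * h2 * h3 * k4)"
        using pos by (simp add: u_def field_simps)
      then show ?thesis by (simp only: of_nat_eq_iff)
    qed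
    have wt: "w ((h1, k1), (h2, k2)) * w ((h3, k3), (h4, k4)) = 1 / real (h1 * k2 * k3 * h4)"
      if "h1 * k2 * k3 * h4 = k1 * h2 * h3 * k4"
    proof -
      have "w ((h1, k1), (h2, k2)) * w ((h3, k3), (h4, k4))
          = 1 / sqrt (real (h1 * k2 * k3 * h4) * real (k1 * h2 * h3 * k4))"
        by (simp add: w_def real_sqrt_mult mult_ac)
      then show ?thesis using that by (simp del: of_nat_mult)
    qed
    show "(\<lambda>(a, b). if m a = m b then 1 / real (m a) else 0)
          ((\<lambda>(((h1, k1), (h2, k2)), ((h3, k3), (h4, k4))). ((h1, k2, k3, h4), (k1, h2, h3, k4))) z)
        = (case z of (i, j) \<Rightarrow> if u i = u j then w i * w j else 0)"
      using eq wt by (simp add: z m_def)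
  qed (auto simp: Z_def T_def)
  also have "\<dots> = (\<Sum>a\<in>T. \<Sum>b\<in>T. if m a = m b then 1 / real (m a) else 0)"
    by (simp add: sum.cartesian_product)
  also have "\<dots> \<le> harm Y ^ 32"
    using sum_four_products_le[of Y] unfolding T_def m_def .
  finally show ?thesis .
qed

text \<open>The first Cauchy-Schwarz separates \<open>d p\<close> from the dilates
  \<open>d q * h / k\<close>. A coincidence among the dilates says that a ratio of two dilation
  factors equals a ratio \<open>d q / d p\<close>; the second Cauchy-Schwarz separates these two
  kinds of ratio.\<close>

lemma dilation_sum_le:
  assumes "finite P" and pos: "\<And>p. p \<in> P \<Longrightarrow> 0 < d p"
  defines "v \<equiv> \<lambda>(p, q). d q / d p"
  shows "dilation_sum P d Y ^ 4 \<le> (coincidence_sum P d (\<lambda>_. 1) P d (\<lambda>_. 1))\<^sup>2 *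
    (harm Y ^ 32 * coincidence_sum (P \<times> P) v (\<lambda>_. 1) (P \<times> P) v (\<lambda>_. 1))"
proof -
  define J where "J = P \<times> {1..Y} \<times> {1..Y}"
  define s where "s = (\<lambda>(q, h, k). d q * real h / real k)"
  define g where "g = (\<lambda>(q::'a, h::nat, k::nat). 1 / sqrt (real h * real k))"
  define Z where "Z = ({1..Y} \<times> {1..Y}) \<times> ({1..Y} \<times> {1..Y})"
  define u where "u = (\<lambda>((h, k), (h', k')). (real h * real k') / (real k * real h'))"
  define w where "w = (\<lambda>((h, k), (h', k')). 1 / sqrt (real h * real k) * (1 / sqrt (real h' * real k')))"
  define E B Q where "E = coincidence_sum P d (\<lambda>_. 1) P d (\<lambda>_. 1)"
    and "B = coincidence_sum J s g J s g"
    and "Q = coincidence_sum (P \<times> P) v (\<lambda>_. 1) (P \<times> P) v (\<lambda>_. 1)"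
  have fin: "finite J" "finite Z" "finite (P \<times> P)" using assms(1) by (auto simp: J_def Z_def)
  have nonneg: "0 \<le> E" "0 \<le> Q" "0 \<le> B"
    unfolding E_def Q_def B_def by (auto intro!: coincidence_sum_nonneg simp: g_def)
  have "B = (\<Sum>(i, j)\<in>J \<times> J. if s i = s j then g i * g j else 0)"
    by (simp add: B_def coincidence_sum_def sum.cartesian_product)
  also have "\<dots> = (\<Sum>(i, j)\<in>Z \<times> (P \<times> P). if u i = v j then w i * 1 else 0)"
  proof (rule sum.reindex_bij_witness
      [where j = "\<lambda>((p, h, k), (q, h', k')). (((h, k), (h', k')), (p, q))"
         and i = "\<lambda>(((h, k), (h', k')), (p, q)). ((p, h, k), (q, h', k'))"])
    fix z assume "z \<in> J \<times> J"
    then obtain p h k q h' k' where z: "z = ((p, h, k), (q, h', k'))"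
      and zpos: "h > 0" "k > 0" "h' > 0" "k' > 0" "d p > 0" "d q > 0"
      using pos by (auto simp: J_def)
    have "s (p, h, k) = s (q, h', k') \<longleftrightarrow> u ((h, k), (h', k')) = v (p, q)"
      using zpos by (simp add: s_def u_def v_def field_simps)
    then show "(\<lambda>(i, j). if u i = v j then w i * 1 else 0)
          ((\<lambda>((p, h, k), (q, h', k')). (((h, k), (h', k')), (p, q))) z)
        = (case z of (i, j) \<Rightarrow> if s i = s j then g i * g j else 0)"
      by (simp add: z g_def w_def)
  qed (auto simp: Z_def J_def)
  also have "\<dots> = coincidence_sum Z u w (P \<times> P) v (\<lambda>_. 1)"
    by (simp add: coincidence_sum_def sum.cartesian_product case_prod_unfold)
  finally have B: "B = coincidence_sum Z u w (P \<times> P) v (\<lambda>_. 1)" .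
  have "B\<^sup>2 \<le> coincidence_sum Z u w Z u w * Q"
    unfolding B Q_def by (rule coincidence_sum_Cauchy_Schwarz) (use fin in auto)
  also have "\<dots> \<le> harm Y ^ 32 * Q"
    using dilation_weights_le[of Y] nonneg by (intro mult_right_mono) (auto simp: Z_def u_def w_def)
  finally have B2: "B\<^sup>2 \<le> harm Y ^ 32 * Q" .
  have "(dilation_sum P d Y)\<^sup>2 \<le> E * B"
    unfolding dilation_sum_def E_def B_def J_def s_def g_def
    by (rule coincidence_sum_Cauchy_Schwarz) (use assms(1) in auto)
  then have "((dilation_sum P d Y)\<^sup>2)\<^sup>2 \<le> (E * B)\<^sup>2" by (rule power_mono) simp
  also have "\<dots> = E\<^sup>2 * B\<^sup>2" by (simp add: power_mult_distrib)
  also have "\<dots> \<le> E\<^sup>2 * (harm Y ^ 32 * Q)" by (intro mult_left_mono B2) simp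
  finally show ?thesis by (simp add: E_def Q_def flip: power_mult)
qed

text \<open>With \<open>d p = g * h\<close> and \<open>d q = g * k\<close> the term is
  \<open>1 / max h k\<close>. It is at most \<open>1 / Y\<close> if the maximum exceeds
  \<open>Y\<close>; otherwise it is at most \<open>1 / sqrt (h * k)\<close>, which is one of the
  terms of the dilation sum because \<open>d p = d q * h / k\<close>.\<close>

lemma gcd_sum_le_dilation_sum:
  fixes d :: "'p \<Rightarrow> nat"
  assumes P: "finite P" and pos: "\<And>p. p \<in> P \<Longrightarrow> 0 < d p" and Y: "Y > 0"
  shows "(\<Sum>p\<in>P. \<Sum>q\<in>P. real (gcd (d p) (d q)) / real (max (d p) (d q)))
    \<le> (real (card P))\<^sup>2 / real Y + dilation_sum P (\<lambda>p. real (d p)) Y"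
proof -
  define t where "t p q h k = (if real (d p) = real (d q) * real h / real k then 1 / sqrt (real h * real k) else 0)"
    for p q :: 'p and h k :: nat
  have t0: "0 \<le> t p q h k" for p q h k by (simp add: t_def)
  have "(\<Sum>p\<in>P. \<Sum>q\<in>P. real (gcd (d p) (d q)) / real (max (d p) (d q)))
      \<le> (\<Sum>p\<in>P. \<Sum>q\<in>P. 1 / real Y + (\<Sum>(h, k)\<in>{1..Y} \<times> {1..Y}. t p q h k))"
  proof (intro sum_mono)
    fix p q assume pq: "p \<in> P" "q \<in> P"
    define g where "g = gcd (d p) (d q)"
    have dpos: "d p > 0" "d q > 0" using pq pos by auto
    then have g: "g > 0" by (simp add: g_def)
    obtain h k where hk: "d p = g * h" "d q = g * k" by (metis g_def gcd_dvd1 gcd_dvd2 dvdE)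
    have hkpos: "h > 0" "k > 0" using dpos hk by (auto intro: Nat.gr0I)
    have eq: "real (gcd (d p) (d q)) / real (max (d p) (d q)) = 1 / real (max h k)"
      using g unfolding g_def[symmetric] unfolding hk by (simp flip: nat_mult_max_right)
    have sum0: "0 \<le> (\<Sum>(h, k)\<in>{1..Y} \<times> {1..Y}. t p q h k)"
      by (auto intro!: sum_nonneg t0)
    show "real (gcd (d p) (d q)) / real (max (d p) (d q)) \<le> 1 / real Y + (\<Sum>(h, k)\<in>{1..Y} \<times> {1..Y}. t p q h k)"
    proof (cases "max h k \<le> Y")
      case True
      have "sqrt (real h * real k) \<le> sqrt (real (max h k) * real (max h k))"
        by (intro real_sqrt_le_mono mult_mono) auto
      then have "sqrt (real h * real k) \<le> real (max h k)" by simp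
      then have "1 / real (max h k) \<le> 1 / sqrt (real h * real k)"
        using hkpos by (intro divide_left_mono) auto
      also have "\<dots> = t p q h k" using hkpos by (simp add: t_def hk)
      also have "\<dots> \<le> (\<Sum>(h, k)\<in>{1..Y} \<times> {1..Y}. t p q h k)"
        using member_le_sum[of "(h, k)" "{1..Y} \<times> {1..Y}" "\<lambda>(h, k). t p q h k"] t0 hkpos True by auto
      finally show ?thesis unfolding eq using Y by (simp add: add_increasing)
    next
      case False
      then have "1 / real (max h k) \<le> 1 / real Y"
        using Y by (intro divide_left_mono) auto
      then show ?thesis unfolding eq using sum0 by simp
    qed
  qed
  also have "\<dots> = (real (card P))\<^sup>2 / real Y + (\<Sum>p\<in>P. \<Sum>q\<in>P. \<Sum>(h, k)\<in>{1..Y} \<times> {1..Y}. t p q h k)"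
    by (simp add: sum.distrib power2_eq_square)
  also have "(\<Sum>p\<in>P. \<Sum>q\<in>P. \<Sum>(h, k)\<in>{1..Y} \<times> {1..Y}. t p q h k) = dilation_sum P (\<lambda>p. real (d p)) Y"
    unfolding dilation_sum_def coincidence_sum_def t_def
    by (simp add: sum.cartesian_product[of _ _ P] case_prod_unfold cong: if_cong)
  finally show ?thesis .
qed

section \<open>Simultaneous approximation of two multiples\<close>

lemma dist_nearest_int_le_iff: "dist_nearest_int x \<le> \<delta> \<longleftrightarrow> (\<exists>z::int. \<bar>x - of_int z\<bar> \<le> \<delta>)"
proof
  assume "\<exists>z::int. \<bar>x - of_int z\<bar> \<le> \<delta>"
  then obtain z :: int where "\<bar>x - of_int z\<bar> \<le> \<delta>" ..
  then show "dist_nearest_int x \<le> \<delta>"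
    unfolding dist_nearest_int_def using round_diff_minimal[of x z] by linarith
qed (auto simp: dist_nearest_int_def)

lemma dist_nearest_int_add_of_int [simp]: "dist_nearest_int (x + of_int k) = dist_nearest_int x"
proof -
  have "round (x + of_int k) = round x + k"
    unfolding round_def using floor_add_int[of "x + 1/2" k] by (simp add: add_ac)
  then show ?thesis by (simp add: dist_nearest_int_def)
qed

lemma dist_nearest_int_add_of_nat [simp]: "dist_nearest_int (x + of_nat k) = dist_nearest_int x"
  using dist_nearest_int_add_of_int[of x "int k"] by simp

text \<open>\<open>round\<close> sends ties upward and so does not commute with negation; the
  sublevel sets are compared instead.\<close>

lemma dist_nearest_int_minus [simp]: "dist_nearest_int (- x) = dist_nearest_int x"
proof -
  have "dist_nearest_int (- x) \<le> \<delta> \<longleftrightarrow> dist_nearest_int x \<le> \<delta>" for \<delta>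
    unfolding dist_nearest_int_le_iff
  proof
    assume "\<exists>z::int. \<bar>- x - of_int z\<bar> \<le> \<delta>"
    then obtain z :: int where "\<bar>- x - of_int z\<bar> \<le> \<delta>" ..
    then show "\<exists>z::int. \<bar>x - of_int z\<bar> \<le> \<delta>" by (intro exI[of _ "- z"]) simp
  next
    assume "\<exists>z::int. \<bar>x - of_int z\<bar> \<le> \<delta>"
    then obtain z :: int where "\<bar>x - of_int z\<bar> \<le> \<delta>" ..
    then show "\<exists>z::int. \<bar>- x - of_int z\<bar> \<le> \<delta>" by (intro exI[of _ "- z"]) simp
  qed
  then show ?thesis by (meson antisym order_refl)
qed

lemma borel_measurable_dist_nearest_int [measurable]: "dist_nearest_int \<in> borel_measurable borel"
  unfolding dist_nearest_int_def[abs_def] round_def by measurable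

text \<open>With \<open>g = gcd n m\<close>, \<open>n = g * h\<close> and \<open>m = g * k\<close>,
  the points are \<open>y + k * j / h\<close>: modulo 1 they run \<open>g\<close> times through
  \<open>h\<close> equally spaced positions, of which at most \<open>2 * \<delta> * h + 1\<close>
  are near an integer.\<close>

lemma card_near_rotation_le:
  fixes y \<delta> :: real and m n :: nat
  assumes "n > 0" "0 \<le> \<delta>"
  shows "real (card {j. j < n \<and> dist_nearest_int (y + real m * real j / real n) \<le> \<delta>})
    \<le> 2 * \<delta> * n + gcd n m"
proof -
  define g where "g = gcd n m"
  obtain h k where hk: "n = g * h" "m = g * k" by (metis g_def gcd_dvd1 gcd_dvd2 dvdE)
  have pos: "g > 0" "h > 0" using assms(1) hk by (auto intro: Nat.gr0I)
  have cop: "coprime h k"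
    using pos hk g_def by (metis gcd_mult_distrib_nat mult_cancel1 nat_mult_1_right coprime_iff_gcd_eq_1 less_numeral_extra(3))
  define S where "S = {j. j < n \<and> dist_nearest_int (y + real m * real j / real n) \<le> \<delta>}"
  define r where "r j = round (y + real m * real j / real n)" for j :: nat
  \<comment> \<open>\<open>v j / h\<close> is the representative of \<open>k * j / h\<close> modulo
    1 closest to \<open>-y\<close>, so nearness confines the integer \<open>v j\<close> to an
    interval of length \<open>2 * \<delta> * h\<close>.\<close>
  define v where "v j = int k * int j - r j * int h" for j :: nat
  define lo hi where "lo = real h * (- y - \<delta>)" and "hi = real h * (- y + \<delta>)"
  have ratio: "real m * real j / real n = real k * real j / real h" for j
    using pos by (simp add: hk)
  have v_bounds: "lo \<le> real_of_int (v j) \<and> real_of_int (v j) \<le> hi" if "j \<in> S" for j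
  proof -
    have "\<bar>y + real k * real j / real h - r j\<bar> \<le> \<delta>"
      using that by (simp add: S_def r_def dist_nearest_int_def ratio)
    moreover have "real_of_int (v j) = real h * (real k * real j / real h - r j)"
      using pos by (simp add: v_def algebra_simps)
    ultimately show ?thesis
      using pos unfolding lo_def hi_def by (auto simp: abs_le_iff intro!: mult_left_mono)
  qed
  have "inj_on (\<lambda>j. (j div h, v j)) S"
  proof (rule inj_onI)
    fix i j assume "(i div h, v i) = (j div h, v j)"
    then have d: "i div h = j div h" and "v i = v j" by auto
    then have "int k * (int i - int j) = (r i - r j) * int h"
      by (simp add: v_def algebra_simps)
    \<comment> \<open>Multiplication by \<open>k\<close> is injective modulo \<open>h\<close>, so
      equal values of \<open>v\<close> force equal residues; the quotient by \<open>h\<close> then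
      tells the \<open>g\<close> rounds apart.\<close>
    then have "int h dvd int k * (int i - int j)" by simp
    moreover have "coprime (int h) (int k)" using cop by simp
    ultimately have "int h dvd int i - int j" by (simp add: coprime_dvd_mult_right_iff)
    then have "int i mod int h = int j mod int h" by (simp add: mod_eq_dvd_iff)
    then have "i mod h = j mod h" by (simp flip: zmod_int)
    with d show "i = j" by (metis div_mult_mod_eq)
  qed
  moreover have "(\<lambda>j. (j div h, v j)) ` S \<subseteq> {..<g} \<times> {\<lceil>lo\<rceil>..\<lfloor>hi\<rfloor>}"
    using v_bounds by (auto simp: S_def hk less_mult_imp_div_less ceiling_le_iff le_floor_iff)
  ultimately have "card S \<le> card ({..<g} \<times> {\<lceil>lo\<rceil>..\<lfloor>hi\<rfloor>})"
    by (intro card_inj_on_le[where f = "\<lambda>j. (j div h, v j)"]) auto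
  then have "real (card S) \<le> real g * real (nat (\<lfloor>hi\<rfloor> - \<lceil>lo\<rceil> + 1))"
    by (simp flip: of_nat_mult add: card_cartesian_product)
  also have "real (nat (\<lfloor>hi\<rfloor> - \<lceil>lo\<rceil> + 1)) \<le> 2 * \<delta> * h + 1"
  proof -
    have "hi - lo = 2 * \<delta> * h" by (simp add: hi_def lo_def algebra_simps)
    moreover have "real_of_int \<lfloor>hi\<rfloor> \<le> hi" "lo \<le> real_of_int \<lceil>lo\<rceil>" by linarith+
    moreover have "0 \<le> 2 * \<delta> * h + 1" using assms(2) by simp
    moreover have "real (nat (\<lfloor>hi\<rfloor> - \<lceil>lo\<rceil> + 1)) = max 0 (real_of_int \<lfloor>hi\<rfloor> - real_of_int \<lceil>lo\<rceil> + 1)"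
      by (simp add: max_def)
    ultimately show ?thesis by linarith
  qed
  finally have "real (card S) \<le> real g * (2 * \<delta> * h + 1)" using pos by (simp add: mult_left_mono)
  also have "\<dots> = 2 * \<delta> * n + g" by (simp add: hk algebra_simps)
  finally show ?thesis by (simp add: S_def g_def)
qed

section \<open>Integration of 1-periodic functions over the unit interval\<close>

abbreviation unit_uniform :: "real measure" where
  "unit_uniform \<equiv> restrict_space lborel {0..<1}"

lemma nn_integral_unit_uniform:
  fixes f :: "real \<Rightarrow> ennreal"
  shows "(\<integral>\<^sup>+x. f x \<partial>unit_uniform) = (\<integral>\<^sup>+x. f x * indicator {0..<1} x \<partial>lborel)"
  by (rule nn_integral_restrict_space) auto

lemma nn_integral_shift_interval:
  fixes f :: "real \<Rightarrow> ennreal"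
  assumes [measurable]: "f \<in> borel_measurable borel"
  shows "(\<integral>\<^sup>+x. f (c + x) * indicator {a..<b} x \<partial>lborel)
    = (\<integral>\<^sup>+x. f x * indicator {c + a..<c + b} x \<partial>lborel)"
proof -
  have "(\<integral>\<^sup>+x. f x * indicator {c + a..<c + b} x \<partial>lborel)
      = ennreal \<bar>1\<bar> * (\<integral>\<^sup>+x. f (c + 1 * x) * indicator {c + a..<c + b} (c + 1 * x) \<partial>lborel)"
    by (rule nn_integral_real_affine) auto
  also have "\<dots> = (\<integral>\<^sup>+x. f (c + x) * indicator {a..<b} x \<partial>lborel)"
    by (auto intro!: nn_integral_cong simp: indicator_def)
  finally show ?thesis by simp
qed

lemma nn_integral_split_interval:
  fixes f :: "real \<Rightarrow> ennreal"
  assumes [measurable]: "f \<in> borel_measurable borel" and "a \<le> b" "b \<le> c"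
  shows "(\<integral>\<^sup>+x. f x * indicator {a..<c} x \<partial>lborel) =
    (\<integral>\<^sup>+x. f x * indicator {a..<b} x \<partial>lborel) + (\<integral>\<^sup>+x. f x * indicator {b..<c} x \<partial>lborel)"
proof -
  have "(\<integral>\<^sup>+x. f x * indicator {a..<c} x \<partial>lborel)
      = (\<integral>\<^sup>+x. f x * indicator {a..<b} x + f x * indicator {b..<c} x \<partial>lborel)"
    using assms by (intro nn_integral_cong) (auto simp: indicator_def)
  also have "\<dots> = (\<integral>\<^sup>+x. f x * indicator {a..<b} x \<partial>lborel) + (\<integral>\<^sup>+x. f x * indicator {b..<c} x \<partial>lborel)"
    by (rule nn_integral_add) auto
  finally show ?thesis .
qed

text \<open>A shift moves the window \<open>[0, 1)\<close> to \<open>[c, c + 1)\<close>; the part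
  beyond 1 returns to \<open>[0, c)\<close> by periodicity.\<close>

lemma nn_integral_periodic_shift:
  fixes f :: "real \<Rightarrow> ennreal"
  assumes f [measurable]: "f \<in> borel_measurable borel" and per: "\<And>x. f (x + 1) = f x"
    and c: "0 \<le> c" "c \<le> 1"
  shows "(\<integral>\<^sup>+x. f (x + c) \<partial>unit_uniform) = (\<integral>\<^sup>+x. f x \<partial>unit_uniform)"
proof -
  have "(\<integral>\<^sup>+x. f (x + c) \<partial>unit_uniform) = (\<integral>\<^sup>+x. f x * indicator {c..<c + 1} x \<partial>lborel)"
    using nn_integral_shift_interval[OF f, of c 0 1] by (simp add: nn_integral_unit_uniform add.commute)
  also have "\<dots> = (\<integral>\<^sup>+x. f x * indicator {c..<1} x \<partial>lborel) + (\<integral>\<^sup>+x. f x * indicator {1 + 0..<1 + c} x \<partial>lborel)"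
    using nn_integral_split_interval[OF f, of c 1 "c + 1"] c by (simp add: add.commute)
  also have "(\<integral>\<^sup>+x. f x * indicator {1 + 0..<1 + c} x \<partial>lborel) = (\<integral>\<^sup>+x. f x * indicator {0..<c} x \<partial>lborel)"
    using per by (subst nn_integral_shift_interval[OF f, symmetric]) (simp add: add.commute)
  also have "(\<integral>\<^sup>+x. f x * indicator {c..<1} x \<partial>lborel) + (\<integral>\<^sup>+x. f x * indicator {0..<c} x \<partial>lborel)
      = (\<integral>\<^sup>+x. f x \<partial>unit_uniform)"
    using nn_integral_split_interval[OF f, of 0 c 1] c by (simp add: nn_integral_unit_uniform add.commute)
  finally show ?thesis .
qed

text \<open>Multiplied by \<open>n\<close>, both sides are the integral over \<open>[0, n)\<close>:
  once by periodicity, once by an affine substitution.\<close>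

lemma nn_integral_periodic_dilate:
  fixes f :: "real \<Rightarrow> ennreal"
  assumes f [measurable]: "f \<in> borel_measurable borel" and per: "\<And>x. f (x + 1) = f x" and n: "n > 0"
  shows "(\<integral>\<^sup>+x. f (x * real n) \<partial>unit_uniform) = (\<integral>\<^sup>+x. f x \<partial>unit_uniform)"
proof -
  have per': "f (real k + x) = f x" for k x
  proof (induction k)
    case (Suc k)
    show ?case using per[of "real k + x"] Suc by (simp add: add_ac)
  qed simp
  have "(\<integral>\<^sup>+x. f x * indicator {0..<real k} x \<partial>lborel) = of_nat k * (\<integral>\<^sup>+x. f x \<partial>unit_uniform)" for k
  proof (induction k)
    case (Suc k)
    have "(\<integral>\<^sup>+x. f x * indicator {real k + 0..<real k + 1} x \<partial>lborel) = (\<integral>\<^sup>+x. f x \<partial>unit_uniform)"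
      by (subst nn_integral_shift_interval[OF f, symmetric]) (simp add: per' nn_integral_unit_uniform)
    then show ?case
      using nn_integral_split_interval[OF f, of 0 "real k" "real (Suc k)"] Suc
      by (simp add: add.commute distrib_right)
  qed simp
  then have "of_nat n * (\<integral>\<^sup>+x. f x \<partial>unit_uniform) = (\<integral>\<^sup>+x. f x * indicator {0..<real n} x \<partial>lborel)" by simp
  also have "\<dots> = ennreal \<bar>real n\<bar> * (\<integral>\<^sup>+x. f (0 + real n * x) * indicator {0..<real n} (0 + real n * x) \<partial>lborel)"
    by (rule nn_integral_real_affine) (use n in auto)
  also have "(\<integral>\<^sup>+x. f (0 + real n * x) * indicator {0..<real n} (0 + real n * x) \<partial>lborel)
      = (\<integral>\<^sup>+x. f (x * real n) \<partial>unit_uniform)"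
    unfolding nn_integral_unit_uniform
    using n by (auto intro!: nn_integral_cong simp: indicator_def mult.commute zero_le_mult_iff)
  finally have "of_nat n * (\<integral>\<^sup>+x. f x \<partial>unit_uniform) = of_nat n * (\<integral>\<^sup>+x. f (x * real n) \<partial>unit_uniform)"
    by (simp add: ennreal_of_nat_eq_real_of_nat)
  then show ?thesis using n by (simp add: ennreal_mult_cancel_left)
qed

section \<open>Measure and correlation of the sets of good approximation\<close>

definition near_set :: "real \<Rightarrow> nat \<Rightarrow> real set" where
  "near_set \<delta> n = {\<alpha>. dist_nearest_int (\<alpha> * real n) \<le> \<delta>}"

lemma near_set_borel [measurable]: "near_set \<delta> n \<in> sets borel"
proof -
  have "{\<alpha> \<in> space borel. dist_nearest_int (\<alpha> * real n) \<le> \<delta>} \<in> sets borel" by measurable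
  then show ?thesis by (simp add: near_set_def)
qed

lemma near_set_periodic: "x + 1 \<in> near_set \<delta> n \<longleftrightarrow> x \<in> near_set \<delta> n"
  using dist_nearest_int_add_of_nat[of "x * real n" n] by (simp add: near_set_def algebra_simps)

lemma indicator_near_set_periodic:
  "indicator (near_set \<delta> n) (x + 1) = (indicator (near_set \<delta> n) x :: 'a :: zero_neq_one)"
  by (simp add: indicator_def near_set_periodic)

text \<open>Dilation reduces to \<open>n = 1\<close>, where the set meets \<open>[0, 1)\<close> in a
  piece of length \<delta> at either end; \<delta> < 1/2 keeps the two apart.\<close>

lemma nn_integral_near_set:
  assumes "n > 0" "0 \<le> \<delta>" "\<delta> < 1/2"
  shows "(\<integral>\<^sup>+x. indicator (near_set \<delta> n) x \<partial>unit_uniform) = ennreal (2 * \<delta>)"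
proof -
  have "(\<integral>\<^sup>+x. indicator (near_set \<delta> n) x \<partial>unit_uniform)
      = (\<integral>\<^sup>+x. indicator (near_set \<delta> 1) (x * real n) \<partial>unit_uniform)"
    by (simp add: near_set_def indicator_def)
  also have "\<dots> = (\<integral>\<^sup>+x. indicator (near_set \<delta> 1) x \<partial>unit_uniform)"
    using assms(1) by (intro nn_integral_periodic_dilate) (auto simp: indicator_near_set_periodic)
  also have "\<dots> = (\<integral>\<^sup>+x. indicator {0..\<delta>} x + indicator {1 - \<delta>..<1} x \<partial>lborel)"
    unfolding nn_integral_unit_uniform
  proof (rule nn_integral_cong)
    fix x :: real
    have "x \<in> near_set \<delta> 1 \<longleftrightarrow> x \<le> \<delta> \<or> 1 - \<delta> \<le> x" if "0 \<le> x" "x < 1"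
    proof
      assume "x \<in> near_set \<delta> 1"
      then obtain z :: int where z: "\<bar>x - of_int z\<bar> \<le> \<delta>" by (auto simp: near_set_def dist_nearest_int_le_iff)
      then have "-1 < real_of_int z" "real_of_int z < 2" using that assms by linarith+
      then have "z = 0 \<or> z = 1" by linarith
      then show "x \<le> \<delta> \<or> 1 - \<delta> \<le> x" using z by auto
    next
      assume "x \<le> \<delta> \<or> 1 - \<delta> \<le> x"
      then have "\<bar>x - of_int 0\<bar> \<le> \<delta> \<or> \<bar>x - of_int 1\<bar> \<le> \<delta>" using that by auto
      then show "x \<in> near_set \<delta> 1" by (auto simp: near_set_def dist_nearest_int_le_iff simp del: of_int_0 of_int_1)
    qed
    then show "indicator (near_set \<delta> 1) x * indicator {0..<1} x
        = (indicator {0..\<delta>} x + indicator {1 - \<delta>..<1} x :: ennreal)"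
      using assms by (auto simp: indicator_def)
  qed
  also have "\<dots> = ennreal \<delta> + ennreal \<delta>"
    using assms by (subst nn_integral_add) auto
  finally show ?thesis using assms by (simp flip: ennreal_plus)
qed

text \<open>The event for \<open>n\<close> is invariant under the rotations by multiples of \<open>1/n\<close>, while these
  rotations move the event for \<open>m\<close> through an equidistributed set of positions.\<close>

lemma nn_integral_near_set_inter_le:
  assumes n: "n > 0" and \<delta>: "0 \<le> \<delta>" "\<delta> < 1/2"
  shows "(\<integral>\<^sup>+x. indicator (near_set \<delta> n) x * indicator (near_set \<delta> m) x \<partial>unit_uniform)
    \<le> ennreal (2 * \<delta> * (2 * \<delta> + gcd n m / n))"
proof -
  let ?I = "\<lambda>x. indicator (near_set \<delta> n) x * indicator (near_set \<delta> m) x :: ennreal"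
  have inv: "indicator (near_set \<delta> n) (x + real j / real n) = (indicator (near_set \<delta> n) x :: ennreal)" for x j
    using n dist_nearest_int_add_of_nat[of "x * real n" j]
    by (simp add: indicator_def near_set_def distrib_right)
  have "of_nat n * (\<integral>\<^sup>+x. ?I x \<partial>unit_uniform) = (\<Sum>j<n. \<integral>\<^sup>+x. ?I x \<partial>unit_uniform)"
    by simp
  \<comment> \<open>Averaging over the \<open>n\<close> rotations: the factor for \<open>n\<close>
    is unchanged, so under the integral the factor for \<open>m\<close> sums to a count of
    rotations.\<close>
  also have "\<dots> = (\<Sum>j<n. \<integral>\<^sup>+x. ?I (x + real j / real n) \<partial>unit_uniform)"
    by (intro sum.cong refl nn_integral_periodic_shift[symmetric]) (auto simp: indicator_near_set_periodic)
  also have "\<dots> = (\<integral>\<^sup>+x. (\<Sum>j<n. ?I (x + real j / real n)) \<partial>unit_uniform)"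
    by (subst nn_integral_sum) (auto intro!: measurable_restrict_space1)
  also have "\<dots> \<le> (\<integral>\<^sup>+x. indicator (near_set \<delta> n) x * ennreal (2 * \<delta> * n + gcd n m) \<partial>unit_uniform)"
  proof (rule nn_integral_mono)
    fix x :: real
    have "(\<Sum>j<n. ?I (x + real j / real n))
        = indicator (near_set \<delta> n) x * (\<Sum>j<n. indicator (near_set \<delta> m) (x + real j / real n))"
      by (simp add: inv sum_distrib_left)
    also have "(\<Sum>j<n. indicator (near_set \<delta> m) (x + real j / real n) :: ennreal)
        = of_nat (card {j \<in> {..<n}. x + real j / real n \<in> near_set \<delta> m})"
      by (simp add: indicator_def Int_def)
    also have "{j \<in> {..<n}. x + real j / real n \<in> near_set \<delta> m}
        = {j. j < n \<and> dist_nearest_int (x * real m + real m * real j / real n) \<le> \<delta>}"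
      by (auto simp: near_set_def algebra_simps)
    also have "of_nat (card \<dots>) \<le> ennreal (2 * \<delta> * n + gcd n m)"
      using card_near_rotation_le[OF n \<delta>(1), of "x * real m" m]
      by (simp add: ennreal_of_nat_eq_real_of_nat ennreal_leI)
    finally show "(\<Sum>j<n. ?I (x + real j / real n)) \<le> indicator (near_set \<delta> n) x * ennreal (2 * \<delta> * n + gcd n m)"
      by (simp add: mult_left_mono)
  qed
  also have "\<dots> = ennreal (2 * \<delta>) * ennreal (2 * \<delta> * n + gcd n m)"
    by (subst nn_integral_multc) (auto simp: nn_integral_near_set[OF n \<delta>] intro!: measurable_restrict_space1)
  also have "\<dots> = ennreal (2 * \<delta> * (2 * \<delta> * n + gcd n m))"
    using \<delta> by (intro ennreal_mult[symmetric]) auto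
  also have "2 * \<delta> * (2 * \<delta> * n + gcd n m) = real n * (2 * \<delta> * (2 * \<delta> + gcd n m / n))"
    using n by (simp add: field_simps)
  also have "ennreal \<dots> = of_nat n * ennreal (2 * \<delta> * (2 * \<delta> + gcd n m / n))"
    using \<delta> by (subst ennreal_mult) (auto simp: ennreal_of_nat_eq_real_of_nat)
  finally show ?thesis
    using n by (simp add: ennreal_mult_le_mult_iff)
qed

lemma emeasure_space_unit_uniform: "emeasure unit_uniform (space unit_uniform) = 1"
  by (simp add: emeasure_restrict_space space_restrict_space)

lemma borel_measurable_unit_uniform:
  "f \<in> borel_measurable borel \<Longrightarrow> f \<in> borel_measurable unit_uniform"
  by (intro measurable_restrict_space1) simp

text \<open>In the expanded square the squared mean cancels and the covariances remain; the diagonal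
  terms obey the same bound as the others.\<close>

lemma variance_near_count_le:
  fixes d :: "'p \<Rightarrow> nat"
  assumes P: "finite P" and pos: "\<And>p. p \<in> P \<Longrightarrow> 0 < d p" and \<delta>: "0 \<le> \<delta>" "\<delta> < 1/2"
  shows "(\<integral>\<^sup>+x. ennreal (((\<Sum>p\<in>P. indicator (near_set \<delta> (d p)) x) - 2 * \<delta> * card P)\<^sup>2) \<partial>unit_uniform)
    \<le> ennreal (2 * \<delta> * (\<Sum>p\<in>P. \<Sum>q\<in>P. real (gcd (d p) (d q)) / real (max (d p) (d q))))"
proof -
  interpret finite_measure unit_uniform
    by (rule finite_measureI) (simp only: emeasure_space_unit_uniform, simp)
  define I :: "'p \<Rightarrow> real \<Rightarrow> real" where "I p = indicator (near_set \<delta> (d p))" for p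
  define \<mu> where "\<mu> = 2 * \<delta> * card P"
  define G where "G p q = real (gcd (d p) (d q)) / real (max (d p) (d q))" for p q
  have I_meas [measurable]: "I p \<in> borel_measurable borel" for p unfolding I_def by measurable
  have int1 [simp]: "integrable unit_uniform (I p)" for p
    by (rule integrable_const_bound[where B = 1])
       (auto simp: I_def indicator_def intro!: borel_measurable_unit_uniform)
  have int2 [simp]: "integrable unit_uniform (\<lambda>x. I p x * I q x)" for p q
    by (rule integrable_const_bound[where B = 1])
       (auto simp: I_def indicator_def intro!: borel_measurable_unit_uniform)
  have E1: "(\<integral>x. I p x \<partial>unit_uniform) = 2 * \<delta>" if "p \<in> P" for p
  proof -
    have "(\<integral>x. I p x \<partial>unit_uniform) = enn2real (\<integral>\<^sup>+x. ennreal (I p x) \<partial>unit_uniform)"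
      by (rule integral_eq_nn_integral[OF borel_measurable_unit_uniform[OF I_meas]]) (simp add: I_def)
    then show ?thesis
      using nn_integral_near_set[OF pos[OF that] \<delta>] \<delta> by (simp add: I_def ennreal_indicator)
  qed
  have half: "(\<integral>x. I p x * I q x \<partial>unit_uniform) \<le> 2 * \<delta> * (2 * \<delta> + gcd (d p) (d q) / d p)"
    if "p \<in> P" "q \<in> P" for p q
  proof -
    have "(\<integral>x. I p x * I q x \<partial>unit_uniform) = enn2real (\<integral>\<^sup>+x. ennreal (I p x * I q x) \<partial>unit_uniform)"
      by (rule integral_eq_nn_integral[OF borel_measurable_integrable[OF int2]]) (simp add: I_def)
    also have "\<dots> \<le> enn2real (ennreal (2 * \<delta> * (2 * \<delta> + gcd (d p) (d q) / d p)))"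
      using nn_integral_near_set_inter_le[OF pos[OF that(1)] \<delta>, of "d q"]
      by (intro enn2real_mono) (simp_all add: I_def ennreal_indicator ennreal_mult)
    also have "\<dots> = 2 * \<delta> * (2 * \<delta> + gcd (d p) (d q) / d p)"
      using \<delta> by (intro enn2real_ennreal) simp
    finally show ?thesis .
  qed
  \<comment> \<open>\<open>half\<close> may be applied with either frequency in the denominator; the
    larger one gives \<open>max\<close>.\<close>
  have E2: "(\<integral>x. I p x * I q x \<partial>unit_uniform) \<le> (2 * \<delta>)\<^sup>2 + 2 * \<delta> * G p q"
    if "p \<in> P" "q \<in> P" for p q
    using half[OF that] half[OF that(2,1)]
    by (auto simp: G_def max_def gcd.commute mult.commute[of "I q _"] power2_eq_square algebra_simps)
  have sq: "((\<Sum>p\<in>P. I p x) - \<mu>)\<^sup>2 = (\<Sum>p\<in>P. \<Sum>q\<in>P. I p x * I q x) - 2 * \<mu> * (\<Sum>p\<in>P. I p x) + \<mu>\<^sup>2" for x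
    by (simp add: power2_diff power2_eq_square sum_product algebra_simps)
  have int: "integrable unit_uniform (\<lambda>x. ((\<Sum>p\<in>P. I p x) - \<mu>)\<^sup>2)"
    unfolding sq by (intro Bochner_Integration.integrable_add Bochner_Integration.integrable_diff
        Bochner_Integration.integrable_sum integrable_mult_right) auto
  have "(\<integral>x. ((\<Sum>p\<in>P. I p x) - \<mu>)\<^sup>2 \<partial>unit_uniform)
      = (\<Sum>p\<in>P. \<Sum>q\<in>P. \<integral>x. I p x * I q x \<partial>unit_uniform) - 2 * \<mu> * (\<Sum>p\<in>P. \<integral>x. I p x \<partial>unit_uniform) + \<mu>\<^sup>2"
    unfolding sq using emeasure_space_unit_uniform by (simp add: measure_def)
  also have "(\<Sum>p\<in>P. \<integral>x. I p x \<partial>unit_uniform) = \<mu>" using E1 by (simp add: \<mu>_def)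
  also have "(\<Sum>p\<in>P. \<Sum>q\<in>P. \<integral>x. I p x * I q x \<partial>unit_uniform) \<le> (\<Sum>p\<in>P. \<Sum>q\<in>P. (2 * \<delta>)\<^sup>2 + 2 * \<delta> * G p q)"
    by (intro sum_mono E2)
  also have "\<dots> = \<mu>\<^sup>2 + 2 * \<delta> * (\<Sum>p\<in>P. \<Sum>q\<in>P. G p q)"
    by (simp add: sum.distrib sum_distrib_left \<mu>_def power2_eq_square)
  finally have "(\<integral>x. ((\<Sum>p\<in>P. I p x) - \<mu>)\<^sup>2 \<partial>unit_uniform) \<le> 2 * \<delta> * (\<Sum>p\<in>P. \<Sum>q\<in>P. G p q)"
    by (simp add: power2_eq_square)
  moreover have "(\<integral>\<^sup>+x. ennreal (((\<Sum>p\<in>P. I p x) - \<mu>)\<^sup>2) \<partial>unit_uniform)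
      = ennreal (\<integral>x. ((\<Sum>p\<in>P. I p x) - \<mu>)\<^sup>2 \<partial>unit_uniform)"
    by (rule nn_integral_eq_integral[OF int]) simp
  ultimately show ?thesis by (simp add: I_def \<mu>_def G_def ennreal_leI)
qed

text \<open>The series of the \<open>f k\<close> from \<open>m\<close> on has finite integral, so it
  converges almost everywhere and its terms tend to 0. The offset \<open>m\<close> permits finitely
  many bad indices.\<close>

lemma AE_tendsto_zero_if_summable_nn_integral:
  fixes f :: "nat \<Rightarrow> 'a \<Rightarrow> real"
  assumes [measurable]: "\<And>k. f k \<in> borel_measurable M" and nonneg: "\<And>k x. 0 \<le> f k x"
    and bound: "\<And>k. k \<ge> m \<Longrightarrow> (\<integral>\<^sup>+x. ennreal (f k x) \<partial>M) \<le> ennreal (c k)"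
    and c: "summable c" "\<And>k. 0 \<le> c k"
  shows "AE x in M. (\<lambda>k. f k x) \<longlonglongrightarrow> 0"
proof -
  have "(\<integral>\<^sup>+x. (\<Sum>k. ennreal (f (k + m) x)) \<partial>M) = (\<Sum>k. \<integral>\<^sup>+x. ennreal (f (k + m) x) \<partial>M)"
    by (rule nn_integral_suminf) simp
  also have "\<dots> \<le> (\<Sum>k. ennreal (c (k + m)))"
    by (intro suminf_le bound) auto
  also have "\<dots> = ennreal (\<Sum>k. c (k + m))"
    using c by (intro suminf_ennreal2) (auto simp: summable_iff_shift)
  finally have "(\<integral>\<^sup>+x. (\<Sum>k. ennreal (f (k + m) x)) \<partial>M) \<noteq> \<infinity>"
    by (auto simp: top_unique)
  then have "AE x in M. (\<Sum>k. ennreal (f (k + m) x)) \<noteq> \<infinity>"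
    by (intro nn_integral_PInf_AE) auto
  then show ?thesis
  proof eventually_elim
    case (elim x)
    then have "summable (\<lambda>k. f (k + m) x)"
      using nonneg by (intro summable_suminf_not_top) auto
    then have "(\<lambda>k. f (k + m) x) \<longlonglongrightarrow> 0" by (rule summable_LIMSEQ_zero)
    then show ?case by (rule LIMSEQ_offset)
  qed
qed

section \<open>Pair correlation and additive energy over pairs of indices\<close>

definition index_gap :: "(nat \<Rightarrow> nat) \<Rightarrow> nat \<times> nat \<Rightarrow> nat" where
  "index_gap a p = a (fst p) - a (snd p)"

lemma card_descending_pairs: "real (card (descending_pairs N)) = real N * (real N - 1) / 2"
proof (induction N)
  case 0
  show ?case by (simp add: descending_pairs_def)
next
  case (Suc N)
  have "descending_pairs (Suc N) = descending_pairs N \<union> {N} \<times> {..<N}"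
    by (auto simp: descending_pairs_def)
  moreover have "descending_pairs N \<inter> {N} \<times> {..<N} = {}"
    by (auto simp: descending_pairs_def)
  ultimately have "card (descending_pairs (Suc N)) = card (descending_pairs N) + N"
    by (simp add: card_Un_disjoint)
  then show ?case using Suc by (simp add: field_simps)
qed

text \<open>The distance to the nearest integer is even, so each descending pair stands for two
  ordered pairs of elements, itself and its reflection; hence the factor 2.\<close>

lemma pair_correlation_eq_near_count:
  assumes "strict_mono a"
  shows "pair_correlation \<alpha> s N a =
    2 / real N * (\<Sum>p\<in>descending_pairs N. indicator (near_set (s / real N) (index_gap a p)) \<alpha>)"
proof -
  define \<delta> where "\<delta> = s / real N"
  define S where "S = {p \<in> descending_pairs N. \<alpha> \<in> near_set \<delta> (index_gap a p)}"
  define f g where "f = (\<lambda>p. (a (fst p), a (snd p)))" and "g = (\<lambda>p. (a (snd p), a (fst p)))"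
  have inj: "inj a" using assms by (rule strict_mono_imp_inj_on)
  have lt: "a i < a j \<longleftrightarrow> i < j" for i j using assms by (simp add: strict_mono_less)
  have S_iff: "p \<in> S \<longleftrightarrow> snd p < fst p \<and> fst p < N \<and>
      dist_nearest_int (\<alpha> * (real (a (fst p)) - real (a (snd p)))) \<le> \<delta>" for p
    using lt[of "snd p" "fst p"] by (auto simp: S_def descending_pairs_def near_set_def index_gap_def of_nat_diff less_imp_le)
  have sym: "dist_nearest_int (\<alpha> * (x - y)) = dist_nearest_int (\<alpha> * (y - x))" for x y
    using dist_nearest_int_minus[of "\<alpha> * (x - y)"] by (simp add: algebra_simps)
  have set_eq: "{(x, y) \<in> truncation a N \<times> truncation a N.
      x \<noteq> y \<and> dist_nearest_int (\<alpha> * (real x - real y)) \<le> \<delta>} = f ` S \<union> g ` S" (is "?L = ?R")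
  proof (intro equalityI subsetI)
    fix z assume "z \<in> ?L"
    then obtain i j where ij: "z = (a i, a j)" "i < N" "j < N" "i \<noteq> j"
      "dist_nearest_int (\<alpha> * (real (a i) - real (a j))) \<le> \<delta>"
      by (auto simp: truncation_def)
    show "z \<in> ?R"
    proof (cases "j < i")
      case True
      then have "(i, j) \<in> S" using ij by (simp add: S_iff)
      then show ?thesis using ij(1) by (force simp: f_def)
    next
      case False
      then have "(j, i) \<in> S" using ij by (simp add: S_iff sym[of "real (a j)"])
      then show ?thesis using ij(1) by (force simp: g_def)
    qed
  next
    fix z assume "z \<in> ?R"
    then consider p where "p \<in> S" "z = f p" | p where "p \<in> S" "z = g p" by blast
    then show "z \<in> ?L"
    proof cases
      case 1
      then show ?thesis using lt[of "snd p" "fst p"] by (auto simp: S_iff f_def truncation_def)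
    next
      case 2
      then show ?thesis using lt[of "snd p" "fst p"]
        by (auto simp: S_iff g_def truncation_def sym[of "real (a (snd p))"])
    qed
  qed
  have fin: "finite S" by (simp add: S_def)
  have "inj_on f S" "inj_on g S"
    using inj by (auto simp: inj_on_def f_def g_def prod_eq_iff dest: injD)
  moreover have "f ` S \<inter> g ` S = {}"
  proof (rule equals0I)
    fix z assume "z \<in> f ` S \<inter> g ` S"
    then obtain p q where "p \<in> S" "q \<in> S" "f p = g q" by auto
    then have "a (fst p) = a (snd q)" "a (snd p) = a (fst q)" "a (snd p) < a (fst p)" "a (snd q) < a (fst q)"
      using lt[of "snd p" "fst p"] lt[of "snd q" "fst q"] by (simp_all add: f_def g_def S_iff)
    then show False by simp
  qed
  ultimately have "card (f ` S \<union> g ` S) = 2 * card S"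
    using fin by (simp add: card_Un_disjoint card_image)
  moreover have "real (card S) = (\<Sum>p\<in>descending_pairs N. indicator (near_set \<delta> (index_gap a p)) \<alpha>)"
    by (simp add: S_def indicator_def Int_def)
  ultimately show ?thesis
    unfolding pair_correlation_def \<delta>_def[symmetric] set_eq by simp
qed

text \<open>Descending pairs represent each difference at most as often as all ordered pairs do, so
  their energy is only part of the full one.\<close>

lemma coincidence_sum_index_gap_le:
  assumes "strict_mono a"
  defines "d \<equiv> \<lambda>p. real (index_gap a p)"
  shows "coincidence_sum (descending_pairs N) d (\<lambda>_. 1) (descending_pairs N) d (\<lambda>_. 1)
    \<le> additive_energy (truncation a N)"
proof -
  define P where "P = descending_pairs N"
  define A where "A = truncation a N"
  define u where "u p = int (a (fst p)) - int (a (snd p))" for p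
  define D where "D = (\<lambda>(x, y). int x - int y) ` (A \<times> A)"
  have finA: "finite A" by (simp add: A_def truncation_def)
  have finD: "finite D" using finA by (simp add: D_def)
  have finP: "finite P" by (simp add: P_def)
  have lt: "a i < a j \<longleftrightarrow> i < j" for i j using assms by (simp add: strict_mono_less)
  have inj: "inj a" using assms(1) by (rule strict_mono_imp_inj_on)
  have d_u: "d p = real_of_int (u p)" if "p \<in> P" for p
  proof -
    \<comment> \<open>Strict monotonicity makes the truncated subtraction in
      \<open>index_gap\<close> exact.\<close>
    have "a (snd p) < a (fst p)" using that by (auto simp: lt P_def descending_pairs_def)
    then show ?thesis by (simp add: d_def u_def index_gap_def of_nat_diff)
  qed
  have uD: "u ` P \<subseteq> D"
    by (force simp: P_def u_def D_def A_def descending_pairs_def truncation_def)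
  have zero: "diff_reps A n = 0" if "n \<notin> D" for n
    using that by (auto simp: diff_reps_def D_def card_eq_0_iff)
  have "coincidence_sum P d (\<lambda>_. 1) P d (\<lambda>_. 1) = coincidence_sum P u (\<lambda>_. 1) P u (\<lambda>_. 1)"
    unfolding coincidence_sum_def by (intro sum.cong refl) (simp add: d_u)
  also have "\<dots> = (\<Sum>n\<in>D. (real (card {p. p \<in> P \<and> u p = n}))\<^sup>2)"
    by (subst coincidence_sum_fibres[OF finP finP finD uD]) (simp add: power2_eq_square)
  also have "\<dots> \<le> (\<Sum>n\<in>D. (real (diff_reps A n))\<^sup>2)"
  proof (intro sum_mono power_mono)
    fix n
    have "card {p. p \<in> P \<and> u p = n} \<le> card {(x, y) \<in> A \<times> A. int x - int y = n}"
    proof (rule card_inj_on_le[where f = "\<lambda>p. (a (fst p), a (snd p))"])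
      show "inj_on (\<lambda>p. (a (fst p), a (snd p))) {p. p \<in> P \<and> u p = n}"
        using inj by (auto simp: inj_on_def prod_eq_iff dest: injD)
      show "finite {(x, y) \<in> A \<times> A. int x - int y = n}"
        by (rule finite_subset[of _ "A \<times> A"]) (use finA in auto)
    qed (auto simp: P_def u_def A_def descending_pairs_def truncation_def)
    then show "real (card {p. p \<in> P \<and> u p = n}) \<le> real (diff_reps A n)" by (simp add: diff_reps_def)
  qed auto
  also have "\<dots> = (\<Sum>\<^sub>\<infinity>n\<in>D. (real (diff_reps A n))\<^sup>2)" using finD by simp
  also have "\<dots> = additive_energy A"
    unfolding additive_energy_def by (rule infsum_cong_neutral) (auto simp: zero)
  finally show ?thesis by (simp add: P_def A_def)
qed

section \<open>The GCD sum under the energy hypothesis\<close>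

lemma harm_le_one_plus_ln:
  assumes "n > 0"
  shows "(harm n :: real) \<le> 1 + ln (real n)"
proof -
  obtain k where n: "n = Suc k" using assms by (cases n) auto
  have "harm (Suc k) - ln (real (Suc k)) \<le> harm (Suc 0) - ln (real (Suc 0))"
    using decseq_harm_diff_ln by (rule decseqD) simp
  then show ?thesis by (simp add: n harm_expand)
qed

text \<open>Balance of logarithms behind 49/2: the squared energy saves 49, the divisor moments cost
  32 and the collinear triples 1, so the fourth power of the dilation sum keeps a saving of 16 and
  the sum itself one of 4.\<close>

lemma gcd_sum_le_of_energy:
  assumes a: "strict_mono a" and N: "N \<ge> 2"
    and energy: "additive_energy (truncation a N) \<le> C' * (real N ^ 3 / ln (real N) powr (49/2))"
  shows "(\<Sum>p\<in>descending_pairs N. \<Sum>q\<in>descending_pairs N.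
      real (gcd (index_gap a p) (index_gap a q)) / real (max (index_gap a p) (index_gap a q)))
    \<le> real N ^ 2 + 4 ^ 12 * (1 + C'\<^sup>2) * real N ^ 3 / ln (real N) ^ 4"
proof -
  define P where "P = descending_pairs N"
  define d where "d = (\<lambda>p. real (index_gap a p))"
  define L where "L = ln (real N)"
  define E where "E = coincidence_sum P d (\<lambda>_. 1) P d (\<lambda>_. 1)"
  define v where "v = (\<lambda>(p, q). d q / d p)"
  define Q where "Q = coincidence_sum (P \<times> P) v (\<lambda>_. 1) (P \<times> P) v (\<lambda>_. 1)"
  \<comment> \<open>With cutoff \<open>N^2\<close> the terms beyond it contribute at most
    \<open>N^2\<close> in total, while \<open>harm (N^2)\<close> is still of order
    \<open>log N\<close>.\<close>
  define S where "S = dilation_sum P d (N\<^sup>2)"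
  have finP: "finite P" by (simp add: P_def)
  have lt: "a i < a j \<longleftrightarrow> i < j" for i j using a by (simp add: strict_mono_less)
  have pos: "index_gap a p > 0" if "p \<in> P" for p
    using that by (auto simp: P_def descending_pairs_def index_gap_def lt)
  \<comment> \<open>\<open>N >= 2\<close> keeps the logarithm away from 0, so constants can be
    absorbed: \<open>1 + 2 * L\<close> and \<open>J + 1\<close> are both at most
    \<open>4 * L\<close>.\<close>
  have L2: "2/3 \<le> L"
  proof -
    have "ln 2 \<le> L" using N by (simp add: L_def)
    then show ?thesis using ln2_ge_two_thirds by linarith
  qed
  then have L0: "L > 0" by linarith
  have E: "0 \<le> E" "E \<le> C' * (real N ^ 3 / L powr (49/2))"
    using coincidence_sum_index_gap_le[OF a, of N] energy
    by (auto simp: E_def P_def d_def L_def intro!: coincidence_sum_nonneg)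
  have "E\<^sup>2 \<le> (C' * (real N ^ 3 / L powr (49/2)))\<^sup>2" using E by (intro power_mono) auto
  also have "\<dots> = C'\<^sup>2 * real N ^ 6 / (L powr (49/2))\<^sup>2"
    by (simp add: power_mult_distrib power_divide flip: power_mult)
  also have "(L powr (49/2))\<^sup>2 = L ^ 49"
    using powr_realpow[OF L0, of 49] by (simp add: power2_eq_square powr_add[symmetric])
  finally have E2: "E\<^sup>2 \<le> C'\<^sup>2 * real N ^ 6 / L ^ 49" .
  have "harm (N\<^sup>2) \<le> 1 + ln (real (N\<^sup>2))" using N by (intro harm_le_one_plus_ln) auto
  also have "\<dots> = 1 + 2 * L" using N by (simp add: L_def ln_realpow)
  finally have H: "harm (N\<^sup>2) \<le> 4 * L" using L2 by linarith
  obtain J where J: "2 ^ J \<le> N" "N < 2 ^ Suc J"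
    using ex_power_ivl1[of 2 N] N by auto
  have "real J * ln 2 = ln (2 ^ J)" by (simp add: ln_realpow)
  also have "\<dots> \<le> L"
    unfolding L_def using J(1) N by (subst ln_le_cancel_iff) (auto simp: numeral_power_le_of_nat_cancel_iff)
  finally have "real J * (2/3) \<le> L"
    using ln2_ge_two_thirds mult_left_mono[of "2/3" "ln 2" "real J"] by auto
  then have J1: "real (J + 1) \<le> 4 * L" using L2 by simp
  have x: "strict_mono (\<lambda>i. real (a i))" using a by (simp add: strict_mono_def)
  have gap: "d p = real (a (fst p)) - real (a (snd p))" if "p \<in> P" for p
    using pos[OF that] by (simp add: d_def index_gap_def of_nat_diff)
  have "Q = coincidence_sum (P \<times> P)
      (\<lambda>(p, q). (real (a (fst q)) - real (a (snd q))) / (real (a (fst p)) - real (a (snd p)))) (\<lambda>_. 1) (P \<times> P)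
      (\<lambda>(p, q). (real (a (fst q)) - real (a (snd q))) / (real (a (fst p)) - real (a (snd p)))) (\<lambda>_. 1)"
    unfolding Q_def coincidence_sum_def v_def
    by (intro sum.cong refl) (auto simp: gap)
  also have "\<dots> \<le> 512 * real N ^ 6 * real (J + 1)"
    unfolding P_def using multiplicative_energy_le[OF x J] by simp
  finally have Q: "Q \<le> 512 * real N ^ 6 * real (J + 1)" .
  have S0: "0 \<le> S"
    unfolding S_def dilation_sum_def by (intro coincidence_sum_nonneg) auto
  have "S ^ 4 \<le> E\<^sup>2 * (harm (N\<^sup>2) ^ 32 * Q)"
    unfolding S_def E_def Q_def v_def
    by (rule dilation_sum_le[OF finP]) (use pos in \<open>auto simp: d_def\<close>)
  also have "\<dots> \<le> (C'\<^sup>2 * real N ^ 6 / L ^ 49) * ((4 * L) ^ 32 * (512 * real N ^ 6 * (4 * L)))"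
  proof (intro mult_mono E2 power_mono H)
    show "Q \<le> 512 * real N ^ 6 * (4 * L)"
      by (rule order_trans[OF Q]) (intro mult_left_mono J1, simp)
    show "0 \<le> Q" unfolding Q_def by (intro coincidence_sum_nonneg) auto
    then show "0 \<le> harm (N\<^sup>2) ^ 32 * Q" by (simp add: harm_nonneg)
  qed (use L0 in \<open>auto simp: harm_nonneg\<close>)
  also have "\<dots> = 4 ^ 33 * 512 * C'\<^sup>2 * real N ^ 12 / L ^ 16"
  proof -
    have "L ^ 49 = L ^ 33 * L ^ 16" by (simp flip: power_add)
    moreover have "(4 * L) ^ 32 * (512 * real N ^ 6 * (4 * L)) = 4 ^ 33 * 512 * real N ^ 6 * L ^ 33"
      using power_add[of L 32 1] by (simp add: power_mult_distrib)
    moreover have "real N ^ 12 = real N ^ 6 * real N ^ 6" by (simp flip: power_add)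
    moreover have "(A * n / (x * y)) * (B * n * x) = B * A * (n * n) / y" if "x \<noteq> 0" for A B n x y :: real
      using that by simp
    moreover have "L ^ 33 \<noteq> 0" using L0 by simp
    ultimately show ?thesis by (simp only:)
  qed
  \<comment> \<open>Rounding up to fourth powers so that the root can be read off:
    \<open>4 ^ 33 * 512 = 2 ^ 75\<close> is below \<open>(4 ^ 12) ^ 4 = 2 ^ 96\<close>, and
    \<open>1 + C'^2\<close> is at least 1.\<close>
  also have "\<dots> \<le> (4 ^ 12) ^ 4 * (1 + C'\<^sup>2) ^ 4 * real N ^ 12 / L ^ 16"
  proof (intro divide_right_mono mult_right_mono mult_mono)
    show "C'\<^sup>2 \<le> (1 + C'\<^sup>2) ^ 4"
      using power_increasing[of 1 4 "1 + C'\<^sup>2"] by simp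
  qed (use L0 in auto)
  also have "A ^ 4 * B ^ 4 * real N ^ 12 / L ^ 16 = (A * B * real N ^ 3 / L ^ 4) ^ 4" for A B
    by (simp add: power_mult_distrib power_divide flip: power_mult)
  finally have S: "S \<le> 4 ^ 12 * (1 + C'\<^sup>2) * real N ^ 3 / L ^ 4"
    using L0 power_le_imp_le_base[of S 3] by simp
  have "(\<Sum>p\<in>P. \<Sum>q\<in>P. real (gcd (index_gap a p) (index_gap a q)) / real (max (index_gap a p) (index_gap a q)))
      \<le> (real (card P))\<^sup>2 / real (N\<^sup>2) + S"
    unfolding S_def d_def using N by (intro gcd_sum_le_dilation_sum finP pos) auto
  also have "(real (card P))\<^sup>2 / real (N\<^sup>2) \<le> (real N ^ 2)\<^sup>2 / real (N\<^sup>2)"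
  proof (intro divide_right_mono power_mono)
    have "card P \<le> card ({..<N} \<times> {..<N})"
      by (rule card_mono) (auto simp: P_def descending_pairs_def)
    then show "real (card P) \<le> real N ^ 2" by (simp add: power2_eq_square flip: of_nat_mult)
  qed auto
  also have "\<dots> = real N ^ 2" using N by (simp add: power2_eq_square)
  finally show ?thesis using S by (simp add: P_def L_def)
qed

section \<open>Convergence\<close>

text \<open>The growth lies between geometric, where consecutive ratios stay away from 1, and
  polynomial, along which no fixed power of the logarithm gives a summable saving.\<close>

definition sparse_subsequence :: "nat \<Rightarrow> nat" where
  "sparse_subsequence k = nat \<lceil>exp (sqrt (real k))\<rceil>"

lemma sparse_subsequence_bounds:
  "exp (sqrt (real k)) \<le> real (sparse_subsequence k)"
  "real (sparse_subsequence k) \<le> exp (sqrt (real k)) + 1"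
proof -
  have "0 \<le> \<lceil>exp (sqrt (real k))\<rceil>" by (simp add: less_le_trans[OF _ exp_ge_zero])
  then have "real (sparse_subsequence k) = real_of_int \<lceil>exp (sqrt (real k))\<rceil>"
    by (simp add: sparse_subsequence_def)
  then show "exp (sqrt (real k)) \<le> real (sparse_subsequence k)"
    "real (sparse_subsequence k) \<le> exp (sqrt (real k)) + 1"
    using le_of_int_ceiling[of "exp (sqrt (real k))"] of_int_ceiling_le_add_one[of "exp (sqrt (real k))"] by auto
qed

lemma mono_sparse_subsequence: "mono sparse_subsequence"
  unfolding sparse_subsequence_def by (intro monoI nat_mono ceiling_mono) simp

lemma sparse_subsequence_pos: "0 < sparse_subsequence k"
  using sparse_subsequence_bounds(1)[of k] exp_gt_zero[of "sqrt (real k)"] by (cases "sparse_subsequence k") auto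

lemma filterlim_sparse_subsequence: "filterlim (\<lambda>k. real (sparse_subsequence k)) at_top sequentially"
proof (rule filterlim_at_top_mono)
  show "filterlim (\<lambda>k. exp (sqrt (real k))) at_top sequentially" by real_asymp
qed (simp add: sparse_subsequence_bounds)

lemma sparse_subsequence_ratio:
  "(\<lambda>k. real (sparse_subsequence (Suc k)) / real (sparse_subsequence k)) \<longlonglongrightarrow> 1"
proof (rule tendsto_sandwich)
  show "(\<lambda>k. 1) \<longlonglongrightarrow> (1::real)" by simp
  show "(\<lambda>k. (exp (sqrt (real (Suc k))) + 1) / exp (sqrt (real k))) \<longlonglongrightarrow> 1" by real_asymp
  show "\<forall>\<^sub>F k in sequentially. 1 \<le> real (sparse_subsequence (Suc k)) / real (sparse_subsequence k)"
    using monoD[OF mono_sparse_subsequence] sparse_subsequence_pos by (simp add: le_divide_eq)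
  show "\<forall>\<^sub>F k in sequentially. real (sparse_subsequence (Suc k)) / real (sparse_subsequence k)
      \<le> (exp (sqrt (real (Suc k))) + 1) / exp (sqrt (real k))"
    using sparse_subsequence_bounds(1) sparse_subsequence_bounds(2)[of "Suc _"]
    by (intro always_eventually allI frac_le) (simp_all del: of_nat_Suc)
qed

text \<open>\<open>c\<close> abstracts the pair count, which is monotone in the number of points and
  in the threshold. Between consecutive values of \<nu> it is caught between the counts at the two
  ends, with \<open>s\<close> moved slightly to absorb the change of threshold. Limits are assumed
  for rational \<open>s\<close> only, since countably many values can share one null set.\<close>

lemma tendsto_of_tendsto_along_subsequence:
  fixes c :: "nat \<Rightarrow> real \<Rightarrow> real" and \<nu> :: "nat \<Rightarrow> nat"
  assumes c_mono: "\<And>M N \<delta> \<epsilon>. M \<le> N \<Longrightarrow> \<delta> \<le> \<epsilon> \<Longrightarrow> c M \<delta> \<le> c N \<epsilon>" and c0: "\<And>N \<delta>. 0 \<le> c N \<delta>"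
    and \<nu>: "mono \<nu>" "\<And>k. 0 < \<nu> k" "filterlim (\<lambda>k. real (\<nu> k)) at_top sequentially"
    and ratio: "(\<lambda>k. real (\<nu> (Suc k)) / real (\<nu> k)) \<longlonglongrightarrow> 1"
    and lim: "\<And>s. s \<in> \<rat> \<Longrightarrow> 0 < s \<Longrightarrow> (\<lambda>k. c (\<nu> k) (s / real (\<nu> k)) / real (\<nu> k)) \<longlonglongrightarrow> 2 * s"
    and s: "0 < s"
  shows "(\<lambda>N. c N (s / real N) / real N) \<longlonglongrightarrow> 2 * s"
proof (rule LIMSEQ_I)
  fix e :: real assume e: "0 < e"
  define \<rho> where "\<rho> k = real (\<nu> (Suc k)) / real (\<nu> k)" for k
  have \<rho>: "\<rho> \<longlonglongrightarrow> 1" using ratio by (simp add: \<rho>_def[abs_def])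
  have \<rho>1: "1 \<le> \<rho> k" for k using monoD[OF \<nu>(1), of k "Suc k"] \<nu>(2) by (simp add: \<rho>_def le_divide_eq)
  \<comment> \<open>The rational neighbours \<open>s1\<close> and \<open>s2\<close> have limits
    within \<open>e\<close> of \<open>2 * s\<close>; the lower bound \<open>s / 2\<close> keeps
    \<open>s2\<close> positive.\<close>
  obtain s1 where s1: "s1 \<in> \<rat>" "s < s1" "s1 < s + e / 2" using Rats_dense_in_real[of s "s + e / 2"] e by auto
  have "max (s / 2) (s - e / 2) < s" using s e by simp
  then obtain s2 where s2: "s2 \<in> \<rat>" "max (s / 2) (s - e / 2) < s2" "s2 < s" using Rats_dense_in_real by blast
  then have s2': "0 < s2" "s - e / 2 < s2" using s by auto
  \<comment> \<open>Bounds valid on a whole gap: the count at one end divided by the index at the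
    other end, the quotient of the two indices being \<rho>.\<close>
  define U where "U k = c (\<nu> (Suc k)) (s1 / real (\<nu> (Suc k))) / real (\<nu> (Suc k)) * \<rho> k" for k
  define W where "W k = c (\<nu> k) (s2 / real (\<nu> k)) / real (\<nu> k) / \<rho> k" for k
  have "U \<longlonglongrightarrow> 2 * s1 * 1"
    unfolding U_def[abs_def] using s1 s by (intro tendsto_mult \<rho> LIMSEQ_Suc[OF lim]) auto
  then have ev1: "\<forall>\<^sub>F k in sequentially. U k < 2 * s + e" by (rule order_tendstoD) (use s1 in auto)
  have "W \<longlonglongrightarrow> 2 * s2 / 1"
    unfolding W_def[abs_def] using s2 s2' by (intro tendsto_divide \<rho> lim) auto
  then have ev2: "\<forall>\<^sub>F k in sequentially. 2 * s - e < W k" by (rule order_tendstoD) (use s2' in auto)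
  \<comment> \<open>Ratios this small ensure that \<open>s / \<nu> k\<close> is at most
    \<open>s1 / \<nu> (Suc k)\<close> and, with the next bound, that \<open>s2 / \<nu> k\<close> is
    at most \<open>s / \<nu> (Suc k)\<close>.\<close>
  have ev3: "\<forall>\<^sub>F k in sequentially. \<rho> k < s1 / s" by (rule order_tendstoD[OF \<rho>]) (use s s1 in auto)
  have ev4: "\<forall>\<^sub>F k in sequentially. \<rho> k < s / s2" by (rule order_tendstoD[OF \<rho>]) (use s2 s2' in auto)
  from ev1 ev2 ev3 ev4 have "\<forall>\<^sub>F k in sequentially. U k < 2 * s + e \<and> 2 * s - e < W k \<and> \<rho> k < s1 / s \<and> \<rho> k < s / s2"
    by eventually_elim auto
  then obtain k0 where k0: "\<And>k. k \<ge> k0 \<Longrightarrow> U k < 2 * s + e \<and> 2 * s - e < W k \<and> \<rho> k < s1 / s \<and> \<rho> k < s / s2"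
    by (auto simp: eventually_sequentially)
  show "\<exists>n0. \<forall>N\<ge>n0. norm (c N (s / real N) / real N - 2 * s) < e"
  proof (intro exI[of _ "\<nu> k0"] allI impI)
    fix N assume N: "\<nu> k0 \<le> N"
    have "\<exists>m. N < \<nu> m"
    proof -
      have "\<forall>\<^sub>F k in sequentially. real N < real (\<nu> k)"
        using \<nu>(3) unfolding filterlim_at_top_dense by blast
      then show ?thesis by (auto simp: eventually_sequentially)
    qed
    define m where "m = (LEAST m. N < \<nu> m)"
    have m: "N < \<nu> m" unfolding m_def using \<open>\<exists>m. N < \<nu> m\<close> by (rule LeastI_ex)
    have "\<not> m \<le> k0" using monoD[OF \<nu>(1), of m k0] m N by auto
    then obtain k where k: "m = Suc k" "k0 \<le> k" by (cases m) auto
    have kN: "\<nu> k \<le> N" using not_less_Least[of k "\<lambda>m. N < \<nu> m"] k by (auto simp: m_def)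
    have Nk: "N \<le> \<nu> (Suc k)" using m k by simp
    note kk = k0[OF k(2)]
    have npos: "0 < real (\<nu> k)" "0 < real N" "0 < real (\<nu> (Suc k))" using \<nu>(2)[of k] \<nu>(2)[of "Suc k"] kN by auto
    have "s / real N \<le> s / real (\<nu> k)" using s npos kN by (intro divide_left_mono) auto
    also have "\<dots> \<le> s1 / real (\<nu> (Suc k))" using kk npos s by (simp add: \<rho>_def field_simps)
    finally have "c N (s / real N) \<le> c (\<nu> (Suc k)) (s1 / real (\<nu> (Suc k)))" by (intro c_mono Nk)
    then have "c N (s / real N) / real N \<le> c (\<nu> (Suc k)) (s1 / real (\<nu> (Suc k))) / real (\<nu> k)"
      using npos kN c0 by (intro frac_le) auto
    also have "\<dots> = U k" using npos by (simp add: U_def \<rho>_def)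
    finally have up: "c N (s / real N) / real N < 2 * s + e" using kk by linarith
    have "s2 / real (\<nu> k) \<le> s / real (\<nu> (Suc k))" using kk npos s2' by (simp add: \<rho>_def field_simps)
    also have "\<dots> \<le> s / real N" using s npos Nk by (intro divide_left_mono) auto
    finally have "c (\<nu> k) (s2 / real (\<nu> k)) \<le> c N (s / real N)" by (intro c_mono kN)
    then have "c (\<nu> k) (s2 / real (\<nu> k)) / real (\<nu> (Suc k)) \<le> c N (s / real N) / real N"
      using npos Nk c0 by (intro frac_le) auto
    moreover have "W k = c (\<nu> k) (s2 / real (\<nu> k)) / real (\<nu> (Suc k))" using npos by (simp add: W_def \<rho>_def)
    ultimately have "2 * s - e < c N (s / real N) / real N" using kk by linarith
    with up show "norm (c N (s / real N) / real N - 2 * s) < e" by (simp add: abs_less_iff)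
  qed
qed

text \<open>The subtracted term is the exact mean: \<open>N * (N - 1) / 2\<close> pairs, each near
  an integer with probability \<open>2 * s / N\<close>, normalized by \<open>2 / N\<close>. The
  hypothesis \<open>2 * s < N\<close> is \<delta> < 1/2.\<close>

lemma variance_pair_correlation_le:
  assumes a: "strict_mono a" and N: "N \<ge> 2" and s: "0 < s" "2 * s < real N"
    and energy: "additive_energy (truncation a N) \<le> C' * (real N ^ 3 / ln (real N) powr (49/2))"
  shows "(\<integral>\<^sup>+\<alpha>. ennreal ((pair_correlation \<alpha> s N a - 2 * s * (real N - 1) / real N)\<^sup>2) \<partial>unit_uniform)
    \<le> ennreal (8 * s / real N + 8 * s * (4 ^ 12 * (1 + C'\<^sup>2)) / ln (real N) ^ 4)"
proof -
  define P where "P = descending_pairs N"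
  define \<delta> where "\<delta> = s / real N"
  define T where "T \<alpha> = (\<Sum>p\<in>P. indicator (near_set \<delta> (index_gap a p)) \<alpha>) - 2 * \<delta> * card P" for \<alpha> :: real
  define G where "G = (\<Sum>p\<in>P. \<Sum>q\<in>P.
      real (gcd (index_gap a p) (index_gap a q)) / real (max (index_gap a p) (index_gap a q)))"
  have N0: "0 < real N" using N by simp
  have pos: "index_gap a p > 0" if "p \<in> P" for p
    using that a by (auto simp: P_def descending_pairs_def index_gap_def strict_mono_less)
  have T_meas: "(\<lambda>\<alpha>. ennreal ((T \<alpha>)\<^sup>2)) \<in> borel_measurable unit_uniform"
    unfolding T_def by (intro borel_measurable_unit_uniform) measurable
  have scale: "(pair_correlation \<alpha> s N a - 2 * s * (real N - 1) / real N)\<^sup>2 = (2 / real N)\<^sup>2 * (T \<alpha>)\<^sup>2" for \<alpha>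
  proof -
    have "pair_correlation \<alpha> s N a - 2 * s * (real N - 1) / real N = 2 / real N * T \<alpha>"
      using N0 by (simp add: pair_correlation_eq_near_count[OF a] T_def P_def \<delta>_def
          card_descending_pairs right_diff_distrib field_simps)
    then show ?thesis by (simp only: power_mult_distrib)
  qed
  have "(\<integral>\<^sup>+\<alpha>. ennreal ((pair_correlation \<alpha> s N a - 2 * s * (real N - 1) / real N)\<^sup>2) \<partial>unit_uniform)
      = ennreal ((2 / real N)\<^sup>2) * (\<integral>\<^sup>+\<alpha>. ennreal ((T \<alpha>)\<^sup>2) \<partial>unit_uniform)"
    unfolding scale by (subst nn_integral_cmult[OF T_meas, symmetric]) (simp add: ennreal_mult)
  also have "\<dots> \<le> ennreal ((2 / real N)\<^sup>2) * ennreal (2 * \<delta> * G)"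
    unfolding T_def G_def using s N0
    by (intro mult_left_mono variance_near_count_le pos) (auto simp: \<delta>_def P_def field_simps)
  also have "\<dots> = ennreal ((2 / real N)\<^sup>2 * (2 * \<delta> * G))"
    using s by (intro ennreal_mult[symmetric] mult_nonneg_nonneg) (auto simp: \<delta>_def G_def intro!: sum_nonneg)
  also have "\<dots> \<le> ennreal ((2 / real N)\<^sup>2 * (2 * \<delta> * (real N ^ 2 + 4 ^ 12 * (1 + C'\<^sup>2) * real N ^ 3 / ln (real N) ^ 4)))"
    unfolding G_def P_def using s
    by (intro ennreal_leI mult_left_mono gcd_sum_le_of_energy a N energy) (auto simp: \<delta>_def)
  also have "(2 / real N)\<^sup>2 * (2 * \<delta> * (real N ^ 2 + K * real N ^ 3 / l)) = 8 * s / real N + 8 * s * K / l" for K l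
    using N0 by (simp add: \<delta>_def power2_eq_square power3_eq_cube add_divide_distrib distrib_left)
  finally show ?thesis .
qed

text \<open>The first bound rests on \<open>exp x >= (1 + x / 4) ^ 4\<close> at
  \<open>x = sqrt k\<close>, hence \<open>256 = 4 ^ 4\<close>; the second on the logarithm being at
  least \<open>sqrt k\<close>.\<close>

lemma inverse_sparse_subsequence_le:
  assumes "k > 0"
  shows "1 / real (sparse_subsequence k) \<le> 256 / real k ^ 2"
    and "1 / ln (real (sparse_subsequence k)) ^ 4 \<le> 1 / real k ^ 2"
proof -
  have sq: "sqrt (real k) ^ 4 = real k ^ 2"
    using power_mult[of "sqrt (real k)" 2 2] by simp
  have "(sqrt (real k) / 4) ^ 4 \<le> (1 + sqrt (real k) / real 4) ^ 4"
    by (intro power_mono) auto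
  also have "\<dots> \<le> exp (sqrt (real k))"
    by (rule exp_ge_one_plus_x_over_n_power_n) (auto intro: order_trans[of _ 0])
  also have "\<dots> \<le> real (sparse_subsequence k)" by (rule sparse_subsequence_bounds)
  finally have "real k ^ 2 / 256 \<le> real (sparse_subsequence k)"
    by (simp add: power_divide sq)
  then show "1 / real (sparse_subsequence k) \<le> 256 / real k ^ 2"
    using assms sparse_subsequence_pos[of k] by (simp add: field_simps)
  have "sqrt (real k) \<le> ln (real (sparse_subsequence k))"
    using sparse_subsequence_bounds(1)[of k] sparse_subsequence_pos[of k] by (subst ln_ge_iff) auto
  then have "real k ^ 2 \<le> ln (real (sparse_subsequence k)) ^ 4"
    unfolding sq[symmetric] by (intro power_mono) auto
  then show "1 / ln (real (sparse_subsequence k)) ^ 4 \<le> 1 / real k ^ 2"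
    using assms by (intro frac_le) auto
qed

text \<open>The variance along the subsequence is \<open>O(1 / k^2)\<close>, so the squared
  deviation from the mean tends to 0 almost everywhere, and the mean itself tends to
  \<open>2 * s\<close>.\<close>

lemma AE_pair_correlation_sparse_subsequence:
  assumes a: "strict_mono a" and s: "0 < s"
    and energy: "\<And>N. N \<ge> 2 \<Longrightarrow>
      additive_energy (truncation a N) \<le> C' * (real N ^ 3 / ln (real N) powr (49/2))"
  shows "AE \<alpha> in unit_uniform.
    (\<lambda>k. pair_correlation \<alpha> s (sparse_subsequence k) a) \<longlonglongrightarrow> 2 * s"
proof -
  define \<nu> where "\<nu> = sparse_subsequence"
  define K :: real where "K = 4 ^ 12 * (1 + C'\<^sup>2)"
  define mean where "mean k = 2 * s * (real (\<nu> k) - 1) / real (\<nu> k)" for k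
  have K: "0 \<le> K" by (simp add: K_def)
  have "\<forall>\<^sub>F k in sequentially. max (2 * s) 2 < real (\<nu> k)"
    using filterlim_sparse_subsequence unfolding filterlim_at_top_dense \<nu>_def by blast
  then obtain k1 where k1: "\<And>k. k \<ge> k1 \<Longrightarrow> 2 * s < real (\<nu> k) \<and> 2 < real (\<nu> k)"
    by (auto simp: eventually_sequentially)
  have mean: "mean \<longlonglongrightarrow> 2 * s"
  proof -
    have "(\<lambda>k. 2 * s * (1 - 1 / real (\<nu> k))) \<longlonglongrightarrow> 2 * s * (1 - 0)"
      unfolding \<nu>_def
      by (intro tendsto_intros tendsto_divide_0[OF tendsto_const] filterlim_at_top_imp_at_infinity
          filterlim_sparse_subsequence)
    moreover have "2 * s * (1 - 1 / real (\<nu> k)) = mean k" for k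
      using sparse_subsequence_pos[of k] by (simp add: mean_def \<nu>_def field_simps)
    ultimately show ?thesis by simp
  qed
  have "AE \<alpha> in unit_uniform. (\<lambda>k. (pair_correlation \<alpha> s (\<nu> k) a - mean k)\<^sup>2) \<longlonglongrightarrow> 0"
  \<comment> \<open>Starting at \<open>max 1 k1\<close> skips \<open>k = 0\<close>, where division
    by zero makes the bound 0, and the indices at which \<open>s / \<nu> k\<close> need not yet be
    below 1/2.\<close>
  proof (rule AE_tendsto_zero_if_summable_nn_integral[where m = "max 1 k1" and c = "\<lambda>k. 8 * s * (256 + K) / real k ^ 2"])
    show "(\<lambda>\<alpha>. (pair_correlation \<alpha> s (\<nu> k) a - mean k)\<^sup>2) \<in> borel_measurable unit_uniform" for k
      unfolding pair_correlation_eq_near_count[OF a] by (intro borel_measurable_unit_uniform) measurable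
    show "(\<integral>\<^sup>+\<alpha>. ennreal ((pair_correlation \<alpha> s (\<nu> k) a - mean k)\<^sup>2) \<partial>unit_uniform)
        \<le> ennreal (8 * s * (256 + K) / real k ^ 2)" if "k \<ge> max 1 k1" for k
    proof -
      have k: "k > 0" "2 * s < real (\<nu> k)" "\<nu> k \<ge> 2" using that k1[of k] by auto
      have "(\<integral>\<^sup>+\<alpha>. ennreal ((pair_correlation \<alpha> s (\<nu> k) a - mean k)\<^sup>2) \<partial>unit_uniform)
          \<le> ennreal (8 * s / real (\<nu> k) + 8 * s * K / ln (real (\<nu> k)) ^ 4)"
        unfolding mean_def K_def by (rule variance_pair_correlation_le[OF a k(3) s k(2) energy[OF k(3)]])
      also have "8 * s / real (\<nu> k) + 8 * s * K / ln (real (\<nu> k)) ^ 4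
          = 8 * s * (1 / real (\<nu> k)) + 8 * s * K * (1 / ln (real (\<nu> k)) ^ 4)" by simp
      also have "ennreal \<dots> \<le> ennreal (8 * s * (256 / real k ^ 2) + 8 * s * K * (1 / real k ^ 2))"
        unfolding \<nu>_def using s K k(1)
        by (intro ennreal_leI add_mono mult_left_mono inverse_sparse_subsequence_le) auto
      also have "8 * s * (256 / real k ^ 2) + 8 * s * K * (1 / real k ^ 2) = 8 * s * (256 + K) / real k ^ 2"
        by (simp add: add_divide_distrib distrib_left)
      finally show ?thesis .
    qed
    have "summable (\<lambda>k. 8 * s * (256 + K) * inverse (real k ^ 2))"
      by (intro summable_mult inverse_power_summable) simp
    then show "summable (\<lambda>k. 8 * s * (256 + K) / real k ^ 2)" by (simp add: divide_inverse)
  qed (use s K in auto)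
  then show ?thesis
  proof eventually_elim
    case (elim \<alpha>)
    then have "(\<lambda>k. sqrt ((pair_correlation \<alpha> s (\<nu> k) a - mean k)\<^sup>2)) \<longlonglongrightarrow> sqrt 0"
      by (rule tendsto_real_sqrt)
    then have "(\<lambda>k. pair_correlation \<alpha> s (\<nu> k) a - mean k) \<longlonglongrightarrow> 0"
      by (simp add: tendsto_rabs_zero_iff)
    from tendsto_add[OF this mean] show ?case by (simp add: \<nu>_def)
  qed
qed

theorem theorem5:
  "\<exists>C::real. C > 0 \<and>
     (\<forall>a :: nat \<Rightarrow> nat. strict_mono a \<longrightarrow>
        (\<exists>C'::real. \<forall>N\<ge>2.
            additive_energy (truncation a N) \<le> C' * (real N ^ 3 / ln (real N) powr C)) \<longrightarrow>
        metric_poissonian a)"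
\<comment> \<open>The exponent is half of \<open>32 + 1 + 16\<close>, the logarithms spent and kept
  in \<open>gcd_sum_le_of_energy\<close>.\<close>
proof (intro exI[of _ "49/2"] conjI allI impI)
  fix a :: "nat \<Rightarrow> nat"
  assume a: "strict_mono a" and "\<exists>C'::real. \<forall>N\<ge>2.
      additive_energy (truncation a N) \<le> C' * (real N ^ 3 / ln (real N) powr (49/2))"
  then obtain C' where energy: "\<And>N. N \<ge> 2 \<Longrightarrow>
      additive_energy (truncation a N) \<le> C' * (real N ^ 3 / ln (real N) powr (49/2))" by auto
  \<comment> \<open>With the factor \<open>1 / N\<close> removed and the threshold as a free
    variable, the count is monotone in both arguments, as the interpolation requires.\<close>
  define c :: "real \<Rightarrow> nat \<Rightarrow> real \<Rightarrow> real"
    where "c \<alpha> N \<delta> = 2 * (\<Sum>p\<in>descending_pairs N. indicator (near_set \<delta> (index_gap a p)) \<alpha>)"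
    for \<alpha> N \<delta>
  have c: "pair_correlation \<alpha> s N a = c \<alpha> N (s / real N) / real N" for \<alpha> s N
    by (simp add: pair_correlation_eq_near_count[OF a] c_def)
  have c0: "0 \<le> c \<alpha> N \<delta>" for \<alpha> N \<delta> by (simp add: c_def sum_nonneg)
  have c_mono: "c \<alpha> M \<delta> \<le> c \<alpha> N \<epsilon>" if "M \<le> N" "\<delta> \<le> \<epsilon>" for \<alpha> M N \<delta> \<epsilon>
  proof -
    have "(\<Sum>p\<in>descending_pairs M. indicator (near_set \<delta> (index_gap a p)) \<alpha>)
        \<le> (\<Sum>p\<in>descending_pairs M. indicator (near_set \<epsilon> (index_gap a p)) \<alpha> :: real)"
      using that(2) by (intro sum_mono) (auto simp: indicator_def near_set_def)
    also have "\<dots> \<le> (\<Sum>p\<in>descending_pairs N. indicator (near_set \<epsilon> (index_gap a p)) \<alpha>)"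
      using that(1) by (intro sum_mono2) (simp_all, auto simp: descending_pairs_def)
    finally show ?thesis by (simp add: c_def)
  qed
  \<comment> \<open>The exceptional null set depends on \<open>s\<close>; a single one serves all
    positive rationals, and outside it the interpolation reaches every real
    \<open>s > 0\<close>.\<close>
  have "AE \<alpha> in unit_uniform. \<forall>s\<in>{s \<in> \<rat>. 0 < s}.
      (\<lambda>k. pair_correlation \<alpha> s (sparse_subsequence k) a) \<longlonglongrightarrow> 2 * s"
    by (intro AE_ball_countable[THEN iffD2] ballI AE_pair_correlation_sparse_subsequence[OF a _ energy])
       (auto intro: countable_subset[OF _ countable_rat])
  then have "AE \<alpha> in unit_uniform. \<forall>s>0. (\<lambda>N. pair_correlation \<alpha> s N a) \<longlonglongrightarrow> 2 * s"
  proof eventually_elim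
    case (elim \<alpha>)
    show ?case
    proof (intro allI impI)
      fix s :: real assume "0 < s"
      then show "(\<lambda>N. pair_correlation \<alpha> s N a) \<longlonglongrightarrow> 2 * s"
        unfolding c
        by (intro tendsto_of_tendsto_along_subsequence[where \<nu> = sparse_subsequence] c_mono c0
            mono_sparse_subsequence sparse_subsequence_pos filterlim_sparse_subsequence sparse_subsequence_ratio)
           (use elim in \<open>auto simp: c\<close>)
    qed
  qed
  \<comment> \<open>Passage to the closed interval and the completed measure: the endpoint 1 is a
    null set, and completion preserves almost-everywhere statements.\<close>
  then have "AE \<alpha> in lborel. \<alpha> \<in> {0..<1} \<longrightarrow> (\<forall>s>0. (\<lambda>N. pair_correlation \<alpha> s N a) \<longlonglongrightarrow> 2 * s)"
    by (subst (asm) AE_restrict_space_iff) auto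
  moreover have "AE \<alpha> in lborel. \<alpha> \<noteq> (1::real)" by (rule AE_lborel_singleton)
  ultimately have "AE \<alpha> in lborel. \<alpha> \<in> {0..1} \<longrightarrow> (\<forall>s>0. (\<lambda>N. pair_correlation \<alpha> s N a) \<longlonglongrightarrow> 2 * s)"
    by eventually_elim auto
  then have "AE \<alpha> in lebesgue. \<alpha> \<in> {0..1} \<longrightarrow> (\<forall>s>0. (\<lambda>N. pair_correlation \<alpha> s N a) \<longlonglongrightarrow> 2 * s)"
    by (rule AE_completion)
  then show "metric_poissonian a"
    unfolding metric_poissonian_def by (subst AE_restrict_space_iff) auto
qed simp

end
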